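(* Let $n\ge 4$ and let $Z$ be a real $4\times n$ matrix all of whose maximal minors are positive. Then $$\mathcal{A}_{2,2,n}(Z)={\rm Gr}(2,4)\cap C_{2,2,n}(Z)={\rm Gr}(2,4)\cap \widetilde{C}_{2,2,n}(Z),$$ where ${\rm Gr}(2,4)$ is embedded in $\mathbb{P}(\bigwedge^2\mathbb{R}^4)\cong\mathbb{P}^5$ by the Plücker embedding.
   Context: All objects are real. Denote by $Z_1,\dots,Z_n\in\mathbb{R}^4$ the columns of $Z$. The non-negative Grassmannian ${\rm Gr}_{\ge 0}(2,n)$ is the set of points of ${\rm Gr}(2,n)$ represented by $2\times n$ matrices $M$ with all $2\times 2$ minors non-negative. The amplituhedron $\mathcal{A}_{2,2,n}(Z)\subset{\rm Gr}(2,4)$ is the set of row spans of the $2\times 4$ matrices $MZ^T$ for $[M]\in{\rm Gr}_{\ge0}(2,n)$. The exterior cyclic polytope $C_{2,2,n}(Z)\subset\mathbb{P}(\bigwedge^2\mathbb{R}^4)$ is the set of points $[\sum_{1\le i<j\le n}\lambda_{ij}\,Z_i\wedge Z_j]$ with all $\lambda_{ij}\ge 0$ and not all zero; equivalently, it is the projective convex hull of the points $(ij):=Z_i\wedge Z_j$. For $Y,L\in\bigwedge^2\mathbb{R}^4$ write $\langle Y\,L\rangle$ for the real number with $Y\wedge L=\langle Y\,L\rangle\, e_1\wedge e_2\wedge e_3\wedge e_4$. A facet of $C_{2,2,n}(Z)$ is called a Schubert facet if its supporting hyperplane $H$ satisfies that $H\cap{\rm Gr}(2,4)$ is a Schubert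 divisor, i.e. $H=\{Y:\langle Y\,L\rangle=0\}$ for some decomposable $L$ (so that $H\cap{\rm Gr}(2,4)$ is the set of lines in $\mathbb{P}^3$ meeting a fixed line). The Schubert exterior cyclic polytope $\widetilde{C}_{2,2,n}(Z)$ is the polytope obtained from $C_{2,2,n}(Z)$ by keeping only the facet inequalities of its Schubert facets and deleting all others. *)

theory Defs
  imports "HOL-Analysis.Analysis"
begin

section \<open>Bivectors of 4-space\<close>

text \<open>
  The space of bivectors is \<open>real ^ 6\<close>, with coordinates taken in the basis
  \<open>e\<^sub>1\<and>e\<^sub>2, e\<^sub>1\<and>e\<^sub>3, e\<^sub>1\<and>e\<^sub>4, e\<^sub>2\<and>e\<^sub>3, e\<^sub>2\<and>e\<^sub>4, e\<^sub>3\<and>e\<^sub>4\<close>, in this order.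
\<close>

type_synonym bivector = "real ^ 6"

definition wedge :: "real ^ 4 \<Rightarrow> real ^ 4 \<Rightarrow> bivector" where
  "wedge u v = vector
     [u$1 * v$2 - u$2 * v$1, u$1 * v$3 - u$3 * v$1, u$1 * v$4 - u$4 * v$1,
      u$2 * v$3 - u$3 * v$2, u$2 * v$4 - u$4 * v$2, u$3 * v$4 - u$4 * v$3]"

text \<open>
  The coefficient of \<open>e\<^sub>1\<and>e\<^sub>2\<and>e\<^sub>3\<and>e\<^sub>4\<close> in \<open>Y\<and>L\<close>; see \<open>pairing_wedge_wedge\<close> below.
\<close>

definition pairing :: "bivector \<Rightarrow> bivector \<Rightarrow> real" where
  "pairing Y L = Y$1 * L$6 - Y$2 * L$5 + Y$3 * L$4 + Y$4 * L$3 - Y$5 * L$2 + Y$6 * L$1"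

definition decomposable :: "bivector \<Rightarrow> bool" where
  "decomposable L \<longleftrightarrow> (\<exists>a b. L = wedge a b)"

lemma wedge_nth:
  "wedge u v $ 1 = u$1 * v$2 - u$2 * v$1"
  "wedge u v $ 2 = u$1 * v$3 - u$3 * v$1"
  "wedge u v $ 3 = u$1 * v$4 - u$4 * v$1"
  "wedge u v $ 4 = u$2 * v$3 - u$3 * v$2"
  "wedge u v $ 5 = u$2 * v$4 - u$4 * v$2"
  "wedge u v $ 6 = u$3 * v$4 - u$4 * v$3"
  unfolding wedge_def vector_def by simp_all

lemma det_4:
  fixes A :: "real ^ 4 ^ 4"
  shows "det A =
    (A$1$1 * A$2$2 - A$1$2 * A$2$1) * (A$3$3 * A$4$4 - A$3$4 * A$4$3)
  - (A$1$1 * A$2$3 - A$1$3 * A$2$1) * (A$3$2 * A$4$4 - A$3$4 * A$4$2)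
  + (A$1$1 * A$2$4 - A$1$4 * A$2$1) * (A$3$2 * A$4$3 - A$3$3 * A$4$2)
  + (A$1$2 * A$2$3 - A$1$3 * A$2$2) * (A$3$1 * A$4$4 - A$3$4 * A$4$1)
  - (A$1$2 * A$2$4 - A$1$4 * A$2$2) * (A$3$1 * A$4$3 - A$3$3 * A$4$1)
  + (A$1$3 * A$2$4 - A$1$4 * A$2$3) * (A$3$1 * A$4$2 - A$3$2 * A$4$1)"
proof -
  have f1: "finite {2::4, 3, 4}" "1 \<notin> {2::4, 3, 4}" by auto
  have f2: "finite {3::4, 4}" "2 \<notin> {3::4, 4}" by auto
  have f3: "finite {4::4}" "3 \<notin> {4::4}" by auto
  show ?thesis
    unfolding det_def UNIV_4
    unfolding sum_over_permutations_insert[OF f1]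
    unfolding sum_over_permutations_insert[OF f2]
    unfolding sum_over_permutations_insert[OF f3]
    unfolding permutes_sing
    by (simp add: sign_swap_id permutation_swap_id sign_compose permutation_compose sign_id
        transpose_def algebra_simps)
qed

lemma pairing_wedge_wedge:
  "pairing (wedge a b) (wedge c d) = det (vector [a, b, c, d] :: real ^ 4 ^ 4)"
  unfolding det_4 pairing_def wedge_nth vector_def by (simp add: algebra_simps)


section \<open>Grassmannians and projective space\<close>

definition grassmannian :: "nat \<Rightarrow> ('a::euclidean_space) set set" where
  "grassmannian k = {V. subspace V \<and> dim V = k}"

definition row_span :: "real ^ 'n ^ 'm \<Rightarrow> (real ^ 'n) set" where
  "row_span M = span (rows M)"

definition proj_point :: "'a::real_vector \<Rightarrow> 'a set" where
  "proj_point w = span {w}"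

text \<open>
  The point of projective space attached to a plane \<open>V\<close> is the line \<open>\<And>\<^sup>2V\<close> of bivectors;
  for \<open>V = span {u, v}\<close> it is \<open>proj_point (wedge u v)\<close>.
\<close>

definition plucker :: "(real ^ 4) set \<Rightarrow> bivector set" where
  "plucker V = span {wedge u v | u v. u \<in> V \<and> v \<in> V}"

definition nonneg_grassmannian_2 :: "(real ^ 'n::{finite,linorder}) set set" where
  "nonneg_grassmannian_2 = {V \<in> grassmannian 2. \<exists>M :: real ^ 'n::{finite,linorder} ^ 2. V = row_span M \<and>
     (\<forall>i j. i < j \<longrightarrow> 0 \<le> det (\<chi> r s. M $ r $ (if s = 1 then i else j) :: real ^ 2 ^ 2))}"

text \<open>
  The columns of the submatrix are put in increasing order explicitly, because the library's
  order on the type \<open>4\<close> is \<open>4 = 0 < 1 < 2 < 3\<close>.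
\<close>

definition maximal_minors_positive :: "real ^ 'n::{finite,linorder} ^ 4 \<Rightarrow> bool" where
  "maximal_minors_positive Z \<longleftrightarrow>
     (\<forall>k :: 4 \<Rightarrow> 'n. k 1 < k 2 \<and> k 2 < k 3 \<and> k 3 < k 4 \<longrightarrow>
        0 < det (\<chi> r s. Z $ r $ k s :: real ^ 4 ^ 4))"


section \<open>The amplituhedron and the exterior cyclic polytopes\<close>

definition amplituhedron :: "real ^ 'n::{finite,linorder} ^ 4 \<Rightarrow> (real ^ 4) set set" where
  "amplituhedron Z =
     {row_span (M ** transpose Z) | M :: real ^ 'n::{finite,linorder} ^ 2. row_span M \<in> nonneg_grassmannian_2}"

definition ext_comb :: "real ^ 'n::{finite,linorder} ^ 4 \<Rightarrow> ('n \<Rightarrow> 'n \<Rightarrow> real) \<Rightarrow> bivector" where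
  "ext_comb Z c = (\<Sum>(i, j)\<in>{(i, j). i < j}. c i j *\<^sub>R wedge (column i Z) (column j Z))"

text \<open>
  The condition \<open>ext_comb Z c \<noteq> 0\<close> only serves to make this a set of points of projective
  space for every \<open>Z\<close>. It is automatic if the maximal minors of \<open>Z\<close> are positive and \<open>n \<ge> 4\<close>.
\<close>

definition ext_cyclic_polytope :: "real ^ 'n::{finite,linorder} ^ 4 \<Rightarrow> bivector set set" where
  "ext_cyclic_polytope Z =
     {proj_point (ext_comb Z c) | c. (\<forall>i j. i < j \<longrightarrow> 0 \<le> c i j) \<and>
        (\<exists>i j. i < j \<and> c i j \<noteq> 0) \<and> ext_comb Z c \<noteq> 0}"

text \<open>
  Faces of a projective polytope are faces of the cone over it: \<open>F\<close> below is a facet of the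
  cone, and the hyperplane \<open>{Y. pairing Y L = 0}\<close> cuts out \<open>F\<close> and has the cone on its
  non-negative side. As the pairing is perfect, every linear hyperplane has this form.
\<close>

definition ext_cyclic_cone :: "real ^ 'n::{finite,linorder} ^ 4 \<Rightarrow> bivector set" where
  "ext_cyclic_cone Z = {ext_comb Z c | c. \<forall>i j. i < j \<longrightarrow> 0 \<le> c i j}"

definition supports_facet ::
    "real ^ 'n::{finite,linorder} ^ 4 \<Rightarrow> bivector \<Rightarrow> bivector set \<Rightarrow> bool" where
  "supports_facet Z L F \<longleftrightarrow>
     F facet_of ext_cyclic_cone Z \<and>
     (\<forall>Y\<in>ext_cyclic_cone Z. 0 \<le> pairing Y L) \<and>
     F = ext_cyclic_cone Z \<inter> {Y. pairing Y L = 0}"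

definition schubert_facet :: "real ^ 'n::{finite,linorder} ^ 4 \<Rightarrow> bivector set \<Rightarrow> bool" where
  "schubert_facet Z F \<longleftrightarrow> (\<exists>L. supports_facet Z L F \<and> decomposable L)"

text \<open>
  A projective point satisfies the homogeneous facet inequalities if one of its representatives
  satisfies all of them simultaneously.
\<close>

definition schubert_ext_cyclic_polytope ::
    "real ^ 'n::{finite,linorder} ^ 4 \<Rightarrow> bivector set set" where
  "schubert_ext_cyclic_polytope Z =
     {proj_point Y | Y. Y \<noteq> 0 \<and>
        (\<forall>F L. schubert_facet Z F \<and> supports_facet Z L F \<longrightarrow> 0 \<le> pairing Y L)}"

end

theory Submission
  imports Defs
begin

text \<open>
  Extend the columns of \<open>Z\<close> to the sequence \<open>\<zeta>\<close> with \<open>\<zeta>\<^sub>a\<^sub>+\<^sub>n = - \<zeta>\<^sub>a\<close>: then every window of length \<open>n\<close> has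
  positive maximal minors and yields the same cone, so that all arguments are cyclically symmetric.

  The hyperplanes of \<open>\<zeta>\<^sub>s \<and> \<zeta>\<^sub>s\<^sub>+\<^sub>1\<close> and of the lines in which a plane spanned by three consecutive points
  meets another such plane cut out Schubert facets. Let \<open>Y = u \<and> v\<close> satisfy their inequalities and put
  \<open>B a b = \<langle>Y \<zeta>\<^sub>a \<zeta>\<^sub>b\<rangle>\<close>, the determinant of the images of \<open>\<zeta>\<^sub>a\<close> and \<open>\<zeta>\<^sub>b\<close> in the quotient plane by
  \<open>span {u, v}\<close>. If \<open>B s (s + t) < 0\<close> for some \<open>0 < t < n\<close>, then \<open>B s (s + k)\<close> changes sign twice as \<open>k\<close> runs
  through the window, and the two sign changes give the rows of a non-negative matrix that represents \<open>Y\<close>.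
  Otherwise the images turn by at most a half turn in each window. If one of them vanishes, \<open>Y\<close> is
  represented by a matrix with a unit row. If none does, dividing the images by the equation of a
  plane of three consecutive points gives a planar polygon that is star-shaped around the origin and
  turns left at every vertex, which comes in from infinity and leaves to infinity inside an angle
  smaller than a half turn; this is impossible.
\<close>

section \<open>Brackets and bivectors\<close>

definition br :: "real ^ 4 \<Rightarrow> real ^ 4 \<Rightarrow> real ^ 4 \<Rightarrow> real ^ 4 \<Rightarrow> real" where
  "br a b c d = pairing (wedge a b) (wedge c d)"

lemma exhaust_6:
  fixes x :: 6
  shows "x = 1 \<or> x = 2 \<or> x = 3 \<or> x = 4 \<or> x = 5 \<or> x = 6"
proof (induct x)
  case (of_int z)
  then have "0 \<le> z" and "z < 6" by simp_all
  then have "z = 0 \<or> z = 1 \<or> z = 2 \<or> z = 3 \<or> z = 4 \<or> z = 5" by arith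
  then show ?case by auto
qed

lemma forall_6: "(\<forall>i::6. P i) \<longleftrightarrow> P 1 \<and> P 2 \<and> P 3 \<and> P 4 \<and> P 5 \<and> P 6"
  by (metis exhaust_6)

lemma UNIV_6: "UNIV = {1::6, 2, 3, 4, 5, 6}"
  using exhaust_6 by auto

lemma sum_6: "sum f (UNIV::6 set) = f 1 + f 2 + f 3 + f 4 + f 5 + f 6"
  for f :: "6 \<Rightarrow> real"
  unfolding UNIV_6 by (simp add: ac_simps)

lemma bivector_eq_iff:
  "Y = L \<longleftrightarrow> Y$1 = L$1 \<and> Y$2 = L$2 \<and> Y$3 = L$3 \<and> Y$4 = L$4 \<and> Y$5 = L$5 \<and> Y$6 = L$6"
  for Y L :: bivector
  by (simp add: vec_eq_iff forall_6)

lemma wedge_linear [simp]: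
  "wedge (a + b) c = wedge a c + wedge b c"
  "wedge c (a + b) = wedge c a + wedge c b"
  "wedge (a - b) c = wedge a c - wedge b c"
  "wedge c (a - b) = wedge c a - wedge c b"
  "wedge (t *\<^sub>R a) c = t *\<^sub>R wedge a c"
  "wedge c (t *\<^sub>R a) = t *\<^sub>R wedge c a"
  "wedge (- a) c = - wedge a c"
  "wedge c (- a) = - wedge c a"
  "wedge a a = 0" "wedge 0 a = 0" "wedge a 0 = 0"
  by (simp_all add: bivector_eq_iff wedge_nth algebra_simps)

lemma wedge_commute: "wedge a b = - wedge b a"
  by (simp add: bivector_eq_iff wedge_nth)

lemma pairing_linear [simp]:
  "pairing (Y + Y') L = pairing Y L + pairing Y' L"
  "pairing Y (L + L') = pairing Y L + pairing Y L'"
  "pairing (Y - Y') L = pairing Y L - pairing Y' L"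
  "pairing Y (L - L') = pairing Y L - pairing Y L'"
  "pairing (t *\<^sub>R Y) L = t * pairing Y L"
  "pairing Y (t *\<^sub>R L) = t * pairing Y L"
  "pairing (- Y) L = - pairing Y L"
  "pairing Y (- L) = - pairing Y L"
  "pairing 0 L = 0" "pairing Y 0 = 0"
  by (simp_all add: pairing_def algebra_simps)

lemma pairing_commute: "pairing Y L = pairing L Y"
  by (simp add: pairing_def algebra_simps)

lemma pairing_sum: "pairing (\<Sum>i\<in>I. f i) L = (\<Sum>i\<in>I. pairing (f i) L)"
  by (induction I rule: infinite_finite_induct) simp_all

lemma br_linear [simp]:
  "br (x + y) b c d = br x b c d + br y b c d"
  "br a (x + y) c d = br a x c d + br a y c d"
  "br a b (x + y) d = br a b x d + br a b y d"
  "br a b c (x + y) = br a b c x + br a b c y"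
  "br (x - y) b c d = br x b c d - br y b c d"
  "br a (x - y) c d = br a x c d - br a y c d"
  "br a b (x - y) d = br a b x d - br a b y d"
  "br a b c (x - y) = br a b c x - br a b c y"
  "br (t *\<^sub>R x) b c d = t * br x b c d"
  "br a (t *\<^sub>R x) c d = t * br a x c d"
  "br a b (t *\<^sub>R x) d = t * br a b x d"
  "br a b c (t *\<^sub>R x) = t * br a b c x"
  "br (- x) b c d = - br x b c d"
  "br a (- x) c d = - br a x c d"
  "br a b (- x) d = - br a b x d"
  "br a b c (- x) = - br a b c x"
  by (simp_all add: br_def)

lemma br_swap:
  "br b a c d = - br a b c d"
  "br a c b d = - br a b c d"
  "br a b d c = - br a b c d"
  by (simp_all add: br_def pairing_def wedge_nth algebra_simps)

lemma br_rotate: "br b c d a = - br a b c d"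
  by (simp add: br_def pairing_def wedge_nth algebra_simps)

lemma br_same [simp]:
  "br a a c d = 0" "br a b a d = 0" "br a b c a = 0" "br a b b d = 0" "br a b c b = 0" "br a b c c = 0"
  by (simp_all add: br_def pairing_def wedge_nth algebra_simps)

lemma vec4_eq_iff: "x = y \<longleftrightarrow> x$1 = y$1 \<and> x$2 = y$2 \<and> x$3 = y$3 \<and> x$4 = y$4"
  for x y :: "real ^ 4"
  by (simp add: vec_eq_iff forall_4)

section \<open>Linear and quadratic relations between brackets\<close>

text \<open>Cramer's rule for five vectors of 4-space, arranged so that a combination of
  \<open>a\<close>, \<open>b\<close>, \<open>c\<close> is exhibited as a vector of
  \<open>span {u, v}\<close>. Such combinations later provide the matrix rows.\<close>

lemma five_vector_relation:
  "br u v b c *\<^sub>R a - br u v a c *\<^sub>R b + br u v a b *\<^sub>R c = br u a b c *\<^sub>R v - br v a b c *\<^sub>R u"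
  by (simp add: vec4_eq_iff br_def pairing_def wedge_nth algebra_simps)

text \<open>The combination in \<open>five_vector_relation\<close> lies in
  \<open>span {u, v}\<close>, so its bracket with \<open>u\<close>, \<open>v\<close>,
  \<open>w\<close> vanishes.\<close>

lemma plucker_relation:
  "br u v x z * br u v y w = br u v x y * br u v z w + br u v x w * br u v y z"
proof -
  have "br u v (br u v y z *\<^sub>R x - br u v x z *\<^sub>R y + br u v x y *\<^sub>R z) w = 0"
    unfolding five_vector_relation by simp
  then show ?thesis by (simp add: algebra_simps)
qed

text \<open>Up to order and sign, the six wedges of four independent vectors are their own dual
  basis for the pairing. The determinant is multiplied out.\<close>

lemma bivector_basis_expansion:
  "br a b c d *\<^sub>R M = pairing M (wedge c d) *\<^sub>R wedge a b - pairing M (wedge b d) *\<^sub>R wedge a c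
     + pairing M (wedge b c) *\<^sub>R wedge a d + pairing M (wedge a d) *\<^sub>R wedge b c
     - pairing M (wedge a c) *\<^sub>R wedge b d + pairing M (wedge a b) *\<^sub>R wedge c d"
  by (simp add: bivector_eq_iff br_def pairing_def wedge_nth algebra_simps)

section \<open>Facets of positive configurations\<close>

text \<open>The bivector of the line in which the planes spanned by \<open>a, b, c\<close> and by \<open>p, q, r\<close> meet.\<close>

definition plane_meet ::
    "real ^ 4 \<Rightarrow> real ^ 4 \<Rightarrow> real ^ 4 \<Rightarrow> real ^ 4 \<Rightarrow> real ^ 4 \<Rightarrow> real ^ 4 \<Rightarrow> bivector" where
  "plane_meet a b c p q r = br a b r c *\<^sub>R wedge p q + br a b p c *\<^sub>R wedge q r
     - br a b q c *\<^sub>R wedge p r"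

text \<open>Up to sign, \<open>br a b x c\<close> and \<open>br x p q r\<close> are the equations of
  the two planes. Signs and zeros of the pairing are thus reduced to those of two functions of a
  single point.\<close>

lemma pairing_plane_meet:
  "pairing (wedge x y) (plane_meet a b c p q r) = br a b y c * br x p q r - br a b x c * br y p q r"
proof -
  have "pairing (wedge x y) (plane_meet a b c p q r)
      = br a b (br x y q r *\<^sub>R p - br x y p r *\<^sub>R q + br x y p q *\<^sub>R r) c"
    unfolding plane_meet_def by (simp add: br_def)
  also have "\<dots> = br a b (br x p q r *\<^sub>R y - br y p q r *\<^sub>R x) c"
    unfolding five_vector_relation ..
  finally show ?thesis by (simp add: mult.commute)
qed

lemma decomposable_plane_meet:
  assumes "br a b q c \<noteq> 0"
  shows "decomposable (plane_meet a b c p q r)"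
proof -
  \<comment> \<open>\<open>?u\<close> lies on the line through \<open>p\<close> and
    \<open>q\<close>, \<open>?v\<close> on the line through \<open>q\<close> and \<open>r\<close>,
    and both lie in the plane of \<open>a\<close>, \<open>b\<close>, \<open>c\<close>.\<close>
  let ?u = "br a b p c *\<^sub>R q - br a b q c *\<^sub>R p" and ?v = "br a b r c *\<^sub>R q - br a b q c *\<^sub>R r"
  have "plane_meet a b c p q r = wedge ((- 1 / br a b q c) *\<^sub>R ?u) ?v"
    using assms wedge_commute[of q p]
    by (simp add: plane_meet_def scaleR_diff_right field_simps)
  then show ?thesis unfolding decomposable_def by blast
qed

definition pos_seq :: "nat \<Rightarrow> (nat \<Rightarrow> real ^ 4) \<Rightarrow> bool" where
  "pos_seq n X \<longleftrightarrow> (\<forall>a b c d. a < b \<and> b < c \<and> c < d \<and> d < n \<longrightarrow> 0 < br (X a) (X b) (X c) (X d))"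

lemma pos_seqD: "pos_seq n X \<Longrightarrow> a < b \<Longrightarrow> b < c \<Longrightarrow> c < d \<Longrightarrow> d < n \<Longrightarrow> 0 < br (X a) (X b) (X c) (X d)"
  unfolding pos_seq_def by blast

lemma pos_seq_nonneg:
  assumes "pos_seq n X" "a \<le> b" "b \<le> c" "c \<le> d" "d < n"
  shows "0 \<le> br (X a) (X b) (X c) (X d)"
proof (cases "a = b \<or> b = c \<or> c = d")
  case False
  then show ?thesis using pos_seqD[OF assms(1), of a b c d] assms by simp
qed auto

definition generators :: "nat \<Rightarrow> (nat \<Rightarrow> real ^ 4) \<Rightarrow> bivector set" where
  "generators n X = {wedge (X a) (X b) | a b. a < b \<and> b < n}"

lemma generatorsI: "a < b \<Longrightarrow> b < n \<Longrightarrow> wedge (X a) (X b) \<in> generators n X"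
  unfolding generators_def by blast

text \<open>The last condition says that the generators on the hyperplane of \<open>L\<close> span it.\<close>

definition facet_functional :: "bivector set \<Rightarrow> bivector \<Rightarrow> bool" where
  "facet_functional G L \<longleftrightarrow> (\<forall>g\<in>G. 0 \<le> pairing g L) \<and> (\<exists>g\<in>G. pairing g L \<noteq> 0) \<and>
     (\<forall>M. (\<forall>g\<in>G. pairing g L = 0 \<longrightarrow> pairing g M = 0) \<longrightarrow> (\<exists>t. M = t *\<^sub>R L))"

lemma facet_functional_edge:
  assumes X: "pos_seq n X" and n: "4 \<le> n"
  shows "facet_functional (generators n X) (wedge (X 0) (X 1))"
  unfolding facet_functional_def
proof (intro conjI allI impI ballI)
  have pair: "pairing (wedge (X a) (X b)) (wedge (X 0) (X 1)) = br (X 0) (X 1) (X a) (X b)" for a b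
    by (simp add: br_def pairing_commute)
  show "0 \<le> pairing g (wedge (X 0) (X 1))" if g: "g \<in> generators n X" for g
  proof -
    obtain a b where ab: "g = wedge (X a) (X b)" "a < b" "b < n"
      using g unfolding generators_def by blast
    show ?thesis
    proof (cases "a = 0")
      case True then show ?thesis unfolding ab pair by simp
    next
      case False
      then show ?thesis using pos_seq_nonneg[OF X, of 0 1 a b] ab(2,3) unfolding ab(1) pair by simp
    qed
  qed
  have "0 < br (X 0) (X 1) (X 2) (X 3)" using pos_seqD[OF X, of 0 1 2 3] n by simp
  then show "\<exists>g\<in>generators n X. pairing g (wedge (X 0) (X 1)) \<noteq> 0"
    using n pair[of 2 3] generatorsI[of 2 3 n X] by force
  fix M assume M: "\<forall>g\<in>generators n X. pairing g (wedge (X 0) (X 1)) = 0 \<longrightarrow> pairing g M = 0"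
  have van: "pairing M (wedge (X a) (X b)) = 0" if "a < b" "b < 4" "a \<le> 1" for a b
  proof -
    have "a = 0 \<or> a = 1" using that by auto
    then have "pairing (wedge (X a) (X b)) (wedge (X 0) (X 1)) = 0"
      unfolding pair by auto
    moreover have "wedge (X a) (X b) \<in> generators n X" using that n by (intro generatorsI) auto
    ultimately have "pairing (wedge (X a) (X b)) M = 0" using M by blast
    then show ?thesis by (simp only: pairing_commute[of M])
  qed
  define D where "D = br (X 0) (X 1) (X 2) (X 3)"
  have "D > 0" unfolding D_def by fact
  \<comment> \<open>The five pairs that meet the edge drop out of the expansion.\<close>
  have eq: "D *\<^sub>R M = pairing M (wedge (X 2) (X 3)) *\<^sub>R wedge (X 0) (X 1)"
    unfolding D_def bivector_basis_expansion using van[of 0 1] van[of 0 2] van[of 0 3] van[of 1 2] van[of 1 3]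
    by simp
  have "M = (1 / D) *\<^sub>R (D *\<^sub>R M)" using \<open>D > 0\<close> by simp
  then have "M = (1 / D) *\<^sub>R pairing M (wedge (X 2) (X 3)) *\<^sub>R wedge (X 0) (X 1)"
    by (simp only: eq)
  then show "\<exists>t. M = t *\<^sub>R wedge (X 0) (X 1)"
    unfolding scaleR_scaleR by (rule exI)
qed

section \<open>Monotone quotients of plane equations\<close>

text \<open>Transitivity of \<open>g' / g <= h' / h <= f' / f\<close>, multiplied out because
  \<open>f\<close> and \<open>g\<close> may be zero.\<close>

lemma cross_ratio_trans:
  fixes g h f g' h' f' :: real
  assumes "g' * h \<le> g * h'" "h' * f \<le> h * f'" "0 < h" "0 < h'" "0 \<le> f" "0 \<le> g"
  shows "g' * f \<le> g * f'"
proof -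
  have "(g' * f) * h \<le> (g * f) * h'" using mult_right_mono[OF assms(1,5)] by (simp add: mult_ac)
  also have "\<dots> \<le> (g * f') * h" using mult_left_mono[OF assms(2,6)] by (simp add: mult_ac)
  finally show ?thesis using \<open>0 < h\<close> by simp
qed

lemma plucker_relation_outer:
  "br u x z v * br u y w v = br u x y v * br u z w v + br u x w v * br u y z v"
proof -
  have "br u x y v = br u v x y" for x y
    using br_swap(2)[of u v x y] br_swap(3)[of u x v y] by simp
  then show ?thesis using plucker_relation[of u v x z y w] by simp
qed

lemma plucker_relation_right:
  "br x z u v * br y w u v = br x y u v * br z w u v + br x w u v * br y z u v"
proof -
  have "br x y u v = br u v x y" for x y
    by (simp add: br_def pairing_commute)
  then show ?thesis using plucker_relation[of u v x z y w] by simp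
qed

text \<open>Both monotonicity statements factor the quotient of the two plane equations into quotients whose
  numerator and denominator share two points; each of these is monotone by a Pluecker relation.\<close>

lemma plane_ratio_left:
  assumes X: "pos_seq n X" and ord: "1 < a" "a < b" "b < p" "p < q" "q < r" "r \<le> N" "N < n"
  shows "br (X b) (X p) (X q) (X r) * br (X 0) (X 1) (X a) (X N)
       \<le> br (X a) (X p) (X q) (X r) * br (X 0) (X 1) (X b) (X N)"
proof -
  note nn = pos_seq_nonneg[OF X] and pp = pos_seqD[OF X]
  let ?B = "\<lambda>a b c d. br (X a) (X b) (X c) (X d)"
  \<comment> \<open>The plane is changed one point at a time: from \<open>p, q, r\<close> to
    \<open>1, q, r\<close>, then to \<open>0, 1, r\<close>, then to \<open>0, 1, N\<close>.\<close>
  have 1: "?B b p q r * ?B 1 a q r \<le> ?B a p q r * ?B 1 b q r"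
  proof -
    have "0 \<le> ?B 1 p q r * ?B a b q r" using ord by (intro mult_nonneg_nonneg nn) auto
    then show ?thesis using plucker_relation_right[of "X 1" "X b" "X q" "X r" "X a" "X p"]
      by (simp add: mult.commute)
  qed
  have 2: "?B 1 b q r * ?B 0 1 a r \<le> ?B 1 a q r * ?B 0 1 b r"
  proof -
    have "0 \<le> ?B 0 1 q r * ?B 1 a b r" using ord by (intro mult_nonneg_nonneg nn) auto
    then show ?thesis using plucker_relation_outer[of "X 1" "X 0" "X b" "X r" "X a" "X q"]
      unfolding br_swap(1)[of "X 1" "X 0"] by (simp add: mult.commute)
  qed
  have 3: "?B 0 1 b r * ?B 0 1 a N \<le> ?B 0 1 a r * ?B 0 1 b N"
  proof -
    have "0 \<le> ?B 0 1 a b * ?B 0 1 r N" using ord by (intro mult_nonneg_nonneg nn) auto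
    then show ?thesis using plucker_relation[of "X 0" "X 1" "X a" "X r" "X b" "X N"]
      by (simp add: mult.commute)
  qed
  have pos: "0 < ?B 1 a q r" "0 < ?B 1 b q r" "0 < ?B 0 1 a r" "0 < ?B 0 1 b r"
    "0 \<le> ?B 0 1 a N" "0 \<le> ?B a p q r"
    using ord by (auto intro!: pp nn)
  have "?B 1 b q r * ?B 0 1 a N \<le> ?B 1 a q r * ?B 0 1 b N"
    by (rule cross_ratio_trans[OF 2 3]) (use pos in auto)
  from cross_ratio_trans[OF 1 this] show ?thesis using pos by auto
qed

lemma plane_ratio_right:
  assumes X: "pos_seq n X" and ord: "1 \<le> p" "p < q" "q < r" "r < a" "a < b" "b < N" "N < n"
  shows "br (X p) (X q) (X r) (X a) * br (X 0) (X 1) (X b) (X N)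
       \<le> br (X p) (X q) (X r) (X b) * br (X 0) (X 1) (X a) (X N)"
proof -
  note nn = pos_seq_nonneg[OF X] and pp = pos_seqD[OF X]
  let ?B = "\<lambda>a b c d. br (X a) (X b) (X c) (X d)"
  \<comment> \<open>Here the chain of planes is \<open>p, q, r\<close>, then \<open>p, q, N\<close>,
    then \<open>0, p, N\<close>, then \<open>0, 1, N\<close>.\<close>
  have 1: "?B p q r a * ?B p q b N \<le> ?B p q r b * ?B p q a N"
  proof -
    have "0 \<le> ?B p q r N * ?B p q a b" using ord by (intro mult_nonneg_nonneg nn) auto
    then show ?thesis using plucker_relation[of "X p" "X q" "X r" "X b" "X a" "X N"]
      by (simp add: mult.commute)
  qed
  have 2: "?B p q a N * ?B 0 p b N \<le> ?B p q b N * ?B 0 p a N"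
  proof -
    have "0 \<le> ?B 0 p q N * ?B p a b N" using ord by (intro mult_nonneg_nonneg nn) auto
    then show ?thesis using plucker_relation_outer[of "X p" "X 0" "X a" "X N" "X q" "X b"]
      unfolding br_swap(1)[of "X p" "X 0"] by (simp add: mult.commute)
  qed
  have 3: "?B 0 p a N * ?B 0 1 b N \<le> ?B 0 p b N * ?B 0 1 a N"
  proof -
    have "0 \<le> ?B 0 1 p N * ?B 0 a b N" using ord by (intro mult_nonneg_nonneg nn) auto
    then show ?thesis using plucker_relation_outer[of "X 0" "X 1" "X a" "X N" "X p" "X b"]
      by (simp add: mult.commute)
  qed
  have pos: "0 < ?B p q a N" "0 < ?B p q b N" "0 < ?B 0 p a N" "0 < ?B 0 p b N"
    "0 \<le> ?B 0 1 b N" "0 \<le> ?B p q r b"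
    using ord by (auto intro!: pp nn)
  have "?B p q a N * ?B 0 1 b N \<le> ?B p q b N * ?B 0 1 a N"
    by (rule cross_ratio_trans[OF 2 3]) (use pos in auto)
  from cross_ratio_trans[OF 1 this] show ?thesis using pos by auto
qed

text \<open>The pairing is the determinant \<open>F b * G a - F a * G b\<close> of the two plane
  equations. \<open>F\<close> is non-negative on the window, and \<open>G\<close> passes from
  non-negative to non-positive values at \<open>p, j, r\<close>. Signs decide unless both points lie
  before \<open>p\<close> or both after \<open>r\<close>; there the quotient is monotone.\<close>

lemma pairing_plane_meet_nonneg:
  assumes X: "pos_seq n X" and j: "2 \<le> j" "j \<le> n - 2" and ab: "a < b" "b < n"
  shows "0 \<le> pairing (wedge (X a) (X b))
    (plane_meet (X 0) (X 1) (X (n - 1)) (X (j - 1)) (X j) (X (j + 1)))"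
proof -
  define N p r where [simp]: "N = n - 1" "p = j - 1" "r = j + 1"
  have ord: "1 \<le> p" "p < j" "j < r" "r \<le> N" "N < n" "p + 1 = j" "j + 1 = r" using j by auto
  have N: "x \<le> N \<longleftrightarrow> x < n" for x using j by auto
  define F G where "F x = br (X 0) (X 1) (X x) (X N)" and "G x = br (X x) (X p) (X j) (X r)" for x
  have F: "0 \<le> F x" if "x < n" for x
  proof (cases "x = 0")
    case False then show ?thesis using pos_seq_nonneg[OF X, of 0 1 x N] that ord N unfolding F_def by simp
  qed (simp add: F_def)
  have G0: "G x = - br (X p) (X j) (X r) (X x)" for x
    unfolding G_def using br_rotate[of "X p" "X j" "X r" "X x"] by simp
  have Gl: "0 \<le> G x" if "x \<le> r" for x
  proof (cases "x \<le> p")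
    case True then show ?thesis using pos_seq_nonneg[OF X, of x p j r] ord unfolding G_def by simp
  next
    case False then have "x = j \<or> x = r" using that ord by auto
    then show ?thesis by (auto simp: G_def)
  qed
  have Gr: "G x \<le> 0" if "p \<le> x" "x < n" for x
  proof (cases "r \<le> x")
    case True then show ?thesis using pos_seq_nonneg[OF X, of p j r x] ord that unfolding G0 by simp
  next
    case False then have "x = j \<or> x = p" using that ord by auto
    then show ?thesis by (auto simp: G_def)
  qed
  have "F a * G b \<le> F b * G a"
  proof -
    consider "a \<le> r" "p \<le> b" | "b < p" | "r < a" by linarith
    then show ?thesis
    proof cases
      case 1
      then have "F a * G b \<le> 0" "0 \<le> F b * G a"
        using F Gl Gr ab by (auto intro: mult_nonneg_nonneg mult_nonneg_nonpos)
      then show ?thesis by linarith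
    next
      case 2
      show ?thesis
      proof (cases "a \<le> 1")
        case True
        then have "a = 0 \<or> a = 1" by auto
        then have "F a = 0" by (auto simp: F_def)
        then show ?thesis using F Gl 2 ab ord by simp
      next
        case False
        then show ?thesis using plane_ratio_left[OF X, of a b p j r N] 2 ab ord
          by (simp add: F_def G_def mult.commute)
      qed
    next
      case 3
      show ?thesis
      proof (cases "b = N")
        case True
        then have "F b = 0" by (simp add: F_def)
        then show ?thesis using F[of a] Gr[of b] ab 3 ord by (simp add: mult_nonneg_nonpos)
      next
        case False
        then have "b < N" using ab N[of b] by auto
        then show ?thesis using plane_ratio_right[OF X, of p j r a b N] 3 ab ord
          by (simp add: F_def G0 mult.commute)
      qed
    qed
  qed
  then show ?thesis unfolding pairing_plane_meet F_def G_def by simp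
qed

text \<open>\<open>F\<close> vanishes on the triangle \<open>0, 1, N\<close> and \<open>G\<close> on
  the triangle \<open>p, j, r\<close>, so the sides of both triangles lie on the hyperplane. The
  triangles may share points; independence is drawn only from \<open>F xj\<close> and
  \<open>G x0\<close> being positive.\<close>

lemma facet_functional_plane_meet:
  assumes X: "pos_seq n X" and j: "2 \<le> j" "j \<le> n - 2"
  shows "facet_functional (generators n X)
    (plane_meet (X 0) (X 1) (X (n - 1)) (X (j - 1)) (X j) (X (j + 1)))"
proof -
  define N p r where Npr: "N = n - 1" "p = j - 1" "r = j + 1"
  have ord: "1 \<le> p" "p < j" "j < r" "r \<le> N" "N < n" using j by (auto simp: Npr)
  define x0 x1 xN xp xj xr where "x0 = X 0" and "x1 = X 1" and "xN = X N" and "xp = X p"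
    and "xj = X j" and "xr = X r"
  note xs = this
  define L where "L = plane_meet x0 x1 xN xp xj xr"
  define F G where "F x = br x0 x1 x xN" and "G x = br x xp xj xr" for x
  have pair: "pairing (wedge x y) L = F y * G x - F x * G y" for x y
    unfolding L_def pairing_plane_meet F_def G_def ..
  have Fj: "0 < F xj" unfolding F_def xs using pos_seqD[OF X] ord by simp
  have G0: "0 < G x0" unfolding G_def xs using pos_seqD[OF X] ord by simp
  have zeros: "F x0 = 0" "F x1 = 0" "F xN = 0" "G xp = 0" "G xj = 0" "G xr = 0"
    by (simp_all add: F_def G_def)
  have gen: "wedge x0 x1 \<in> generators n X" "wedge x0 xN \<in> generators n X" "wedge x1 xN \<in> generators n X"
    "wedge xp xj \<in> generators n X" "wedge xp xr \<in> generators n X" "wedge xj xr \<in> generators n X"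
    "wedge x0 xj \<in> generators n X"
    unfolding xs using ord by (auto intro!: generatorsI)
  have tight: "M = t *\<^sub>R L" if M: "\<forall>g\<in>generators n X. pairing g L = 0 \<longrightarrow> pairing g M = 0"
    and t: "t = pairing (wedge x0 xj) M / pairing (wedge x0 xj) L" for M t
  proof -
    \<comment> \<open>Subtracting \<open>t *\<^sub>R L\<close> makes \<open>M'\<close> vanish on the
      pair \<open>x0, xj\<close> too; the claim becomes \<open>M' = 0\<close>.\<close>
    define M' where "M' = M - t *\<^sub>R L"
    have M'0: "pairing g M' = 0" if "g \<in> generators n X" "pairing g L = 0" for g
      using M that by (simp add: M'_def)
    have v: "pairing M' (wedge x0 x1) = 0" "pairing M' (wedge x0 xN) = 0" "pairing M' (wedge x1 xN) = 0"
      "pairing (wedge xp xj) M' = 0" "pairing (wedge xj xr) M' = 0"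
      using gen M'0 by (simp_all add: pair zeros pairing_commute[of M'])
    have v0: "pairing M' (wedge x0 xj) = 0"
      using Fj G0 by (simp add: M'_def t pair zeros pairing_commute[of _ "wedge x0 xj"])
    \<comment> \<open>These are the only coefficients of \<open>M'\<close> that survive in the basis
      from \<open>x0, x1, xN, xj\<close>.\<close>
    define al be where "al = pairing M' (wedge xN xj)" and "be = pairing M' (wedge x1 xj)"
    have D: "F xj = - br x0 x1 xN xj" unfolding F_def by (rule br_swap)
    have M': "(- F xj) *\<^sub>R M' = al *\<^sub>R wedge x0 x1 - be *\<^sub>R wedge x0 xN"
      using bivector_basis_expansion[of x0 x1 xN xj M'] v v0 unfolding D al_def be_def by simp
    let ?P = "\<lambda>x y. br x0 xj x y"
    have sw: "br x y x0 xj = ?P x y" "br x0 x xj y = - ?P x y" "br x0 x y xj = ?P x y" for x y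
      using br_swap(2)[of x0 xj x y] br_swap(3)[of x0 x xj y] by (simp_all add: br_def pairing_commute)
    have "pairing (wedge xp xj) (al *\<^sub>R wedge x0 x1 - be *\<^sub>R wedge x0 xN) = 0"
      unfolding M'[symmetric] using v by simp
    then have e1: "al * ?P x1 xp = be * ?P xN xp"
      using sw(3)[of x1 xp] sw(3)[of xN xp] by (simp add: br_def pairing_commute)
    have "pairing (wedge xj xr) (al *\<^sub>R wedge x0 x1 - be *\<^sub>R wedge x0 xN) = 0"
      unfolding M'[symmetric] using v by simp
    then have e2: "al * ?P x1 xr = be * ?P xN xr"
      using sw(2)[of x1 xr] sw(2)[of xN xr] by (simp add: br_def pairing_commute)
    \<comment> \<open>\<open>e1\<close> and \<open>e2\<close> form a linear system for
      \<open>al\<close> and \<open>be\<close>, whose determinant is \<open>F xj * G x0\<close> by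
      the Pluecker relation.\<close>
    have "?P x1 xp * ?P xN xr - ?P x1 xr * ?P xN xp = ?P x1 xN * ?P xp xr"
      using plucker_relation[of x0 xj x1 xp xN xr] by simp
    moreover have "?P x1 xN = - F xj" using D sw(3)[of x1 xN] by simp
    moreover have "?P xp xr = - G x0" using sw(2)[of xp xr] by (simp add: G_def)
    ultimately have det: "?P x1 xp * ?P xN xr - ?P x1 xr * ?P xN xp \<noteq> 0" using Fj G0 by simp
    have "al * (?P x1 xp * ?P xN xr - ?P x1 xr * ?P xN xp)
        = (al * ?P x1 xp) * ?P xN xr - (al * ?P x1 xr) * ?P xN xp" by (simp add: algebra_simps)
    also have "\<dots> = 0" unfolding e1 e2 by simp
    finally have al: "al = 0" using det by simp
    have "be * (?P x1 xp * ?P xN xr - ?P x1 xr * ?P xN xp)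
        = ?P x1 xp * (be * ?P xN xr) - ?P x1 xr * (be * ?P xN xp)" by (simp add: algebra_simps)
    also have "\<dots> = 0" unfolding e1[symmetric] e2[symmetric] by simp
    finally have "be = 0" using det by simp
    with al M' Fj show ?thesis by (simp add: M'_def)
  qed
  have "facet_functional (generators n X) L"
    unfolding facet_functional_def
  proof (intro conjI allI impI ballI)
    show "0 \<le> pairing g L" if "g \<in> generators n X" for g
      using that pairing_plane_meet_nonneg[OF X j] unfolding generators_def L_def xs Npr by auto
    show "\<exists>g\<in>generators n X. pairing g L \<noteq> 0"
      using gen(7) Fj G0 by (intro bexI[of _ "wedge x0 xj"]) (auto simp: pair zeros)
    show "\<exists>t. M = t *\<^sub>R L" if "\<forall>g\<in>generators n X. pairing g L = 0 \<longrightarrow> pairing g M = 0" for M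
      using tight[OF that refl] by blast
  qed
  then show ?thesis unfolding L_def xs Npr .
qed

section \<open>A strictly positive functional on the generators\<close>

text \<open>It guarantees that non-negative combinations of generators do not cancel, which gives
  non-zero bivectors and independent rows later.\<close>

lemma ex_positive_functional:
  assumes X: "pos_seq n X" and n: "4 \<le> n"
  shows "\<exists>L. \<forall>g\<in>generators n X. 0 < pairing g L"
proof -
  define N where "N = n - 1"
  have N: "3 \<le> N" "N < n" "x < n \<longleftrightarrow> x \<le> N" for x using n by (auto simp: N_def)
  \<comment> \<open>\<open>Q\<close> adds the functionals of three consecutive edges of the cyclic
    polygon. It vanishes only on the generators of the pairs \<open>0, N - 1\<close> and
    \<open>0, N\<close> and \<open>1, N\<close>, and \<open>R\<close> is chosen positive on
    these.\<close>
  define Q where "Q = wedge (X 0) (X N) + wedge (X 0) (X 1) + wedge (X (N - 1)) (X N)"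
  define R where "R = wedge (X 1) (X (N - 1)) - wedge (X 1) (X N) - wedge (X 0) (X (N - 1))"
  have *: "0 < pairing g Q \<or> pairing g Q = 0 \<and> 0 < pairing g R" if "g \<in> generators n X" for g
  proof -
    obtain a b where g: "g = wedge (X a) (X b)" and ab: "a < b" "b < n"
      using \<open>g \<in> generators n X\<close> unfolding generators_def by blast
    let ?B = "\<lambda>a b c d. br (X a) (X b) (X c) (X d)"
    have Q: "pairing g Q = ?B 0 a b N + ?B 0 1 a b + ?B a b (N - 1) N"
      unfolding g Q_def
      using br_rotate[of "X 0" "X a" "X b" "X N"] br_swap(3)[of "X a" "X b" "X N" "X 0"]
      by (simp add: br_def pairing_commute)
    have nn: "0 \<le> ?B 0 a b N" using pos_seq_nonneg[OF X, of 0 a b N] ab N by simp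
    have nn1: "0 \<le> ?B 0 1 a b"
      using pos_seq_nonneg[OF X, of 0 1 a b] ab by (cases "a = 0") simp_all
    have nn2: "0 \<le> ?B a b (N - 1) N"
    proof (cases "b = N")
      case False
      then show ?thesis using pos_seq_nonneg[OF X, of a b "N - 1" N] ab N(2) N(3)[of b] by simp
    qed simp
    have D: "0 < ?B 0 1 (N - 1) N" using pos_seqD[OF X, of 0 1 "N - 1" N] N by simp
    consider "0 < a" "b < N" | "1 < a" | "b < N - 1"
      | "a = 0" "b = N - 1" | "a = 0" "b = N" | "a = 1" "b = N"
      using ab N(3)[of b] by linarith
    then show ?thesis
    proof cases
      case 1
      then have "0 < ?B 0 a b N" using pos_seqD[OF X, of 0 a b N] ab N by simp
      then show ?thesis using nn1 nn2 Q by linarith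
    next
      case 2
      then have "0 < ?B 0 1 a b" using pos_seqD[OF X, of 0 1 a b] ab N by simp
      then show ?thesis using nn nn2 Q by linarith
    next
      case 3
      then have "0 < ?B a b (N - 1) N" using pos_seqD[OF X, of a b "N - 1" N] ab N by simp
      then show ?thesis using nn nn1 Q by linarith
    next
      case 4
      have "pairing g R = ?B 0 1 (N - 1) N"
        using br_swap(2)[of "X 0" "X 1" "X (N - 1)" "X N"] br_same(5) br_same(2)
        unfolding g 4 R_def br_def by simp
      then show ?thesis using D by (simp add: Q 4)
    next
      case 5
      have "pairing g R = ?B 0 1 (N - 1) N"
        using br_swap(2)[of "X 0" "X 1" "X N" "X (N - 1)"] br_swap(3)[of "X 0" "X 1" "X N" "X (N - 1)"]
          br_same(5) br_same(2)
        unfolding g 5 R_def br_def by simp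
      then show ?thesis using D by (simp add: Q 5)
    next
      case 6
      have "pairing g R = ?B 0 1 (N - 1) N"
        using br_rotate[of "X 0" "X 1" "X N" "X (N - 1)"] br_swap(3)[of "X 0" "X 1" "X N" "X (N - 1)"]
          br_swap(3)[of "X 1" "X N" "X 0" "X (N - 1)"] br_same(2) br_same(5)
          pairing_commute[of "wedge (X 1) (X N)" "wedge (X (N - 1)) (X 0)"]
        unfolding g 6 R_def br_def by simp
      then show ?thesis using D by (simp add: Q 6)
    qed
  qed
  have fin: "finite (generators n X)"
  proof (rule finite_subset)
    show "generators n X \<subseteq> (\<lambda>(a, b). wedge (X a) (X b)) ` ({..<n} \<times> {..<n})"
      unfolding generators_def by force
  qed simp
  \<comment> \<open>There are finitely many generators, so one large \<open>K\<close> serves for all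
    of them.\<close>
  have "\<forall>\<^sub>F K in at_top. \<forall>g\<in>generators n X. 0 < pairing g (K *\<^sub>R Q + R)"
  proof (rule eventually_ball_finite[OF fin], rule ballI)
    fix g assume "g \<in> generators n X"
    from *[OF this] show "\<forall>\<^sub>F K in at_top. 0 < pairing g (K *\<^sub>R Q + R)"
    proof
      assume q: "0 < pairing g Q"
      show ?thesis using eventually_gt_at_top[of "- pairing g R / pairing g Q"]
        by eventually_elim (use q in \<open>simp add: field_simps\<close>)
    qed simp
  qed
  then obtain K where "\<forall>g\<in>generators n X. 0 < pairing g (K *\<^sub>R Q + R)"
    using eventually_happens'[OF trivial_limit_at_top_linorder[where 'a = real]] by blast
  then show ?thesis by blast
qed

section \<open>Cyclic windows of the columns\<close>

definition idx :: "nat \<Rightarrow> 'n::{finite,linorder}" where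
  "idx i = sorted_list_of_set UNIV ! i"

lemma idx_less:
  assumes "i < j" "j < CARD('n)"
  shows "(idx i :: 'n::{finite,linorder}) < idx j"
  unfolding idx_def using assms
  by (intro sorted_wrt_nth_less[OF strict_sorted_list_of_set]) simp_all

lemma idx_surj: "\<exists>i<CARD('n). idx i = (x :: 'n::{finite,linorder})"
proof -
  have "x \<in> set (sorted_list_of_set UNIV)" by simp
  then show ?thesis unfolding in_set_conv_nth idx_def by simp
qed

text \<open>Index reduction and sign are placed on the unit vectors instead of the columns. A
  coefficient vector written in any window is then an ordinary row, to which \<open>Z\<close> can be
  applied.\<close>

definition sunit :: "nat \<Rightarrow> real ^ 'n::{finite,linorder}" where
  "sunit a = (- 1) ^ (a div CARD('n)) *\<^sub>R axis (idx (a mod CARD('n))) 1"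

lemma sunit_less: "a < CARD('n) \<Longrightarrow> (sunit a :: real ^ 'n::{finite,linorder}) = axis (idx a) 1"
  unfolding sunit_def by simp

lemma sunit_add_card: "(sunit (a + CARD('n)) :: real ^ 'n::{finite,linorder}) = - sunit a"
  unfolding sunit_def by simp

definition zeta :: "real ^ 'n::{finite,linorder} ^ 4 \<Rightarrow> nat \<Rightarrow> real ^ 4" where
  "zeta Z a = Z *v sunit a"

lemma zeta_less: "a < CARD('n) \<Longrightarrow> zeta Z a = column (idx a) (Z :: real ^ 'n::{finite,linorder} ^ 4)"
  unfolding zeta_def by (simp add: sunit_less matrix_vector_mult_basis)

lemma zeta_add_card: "zeta Z (a + CARD('n)) = - zeta Z a"
  for Z :: "real ^ 'n::{finite,linorder} ^ 4"
  unfolding zeta_def sunit_add_card by (simp add: vec.neg)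

text \<open>Shifting the window moves its first point to the end. The cyclic shift of a bracket
  changes its sign, and so does \<open>zeta\<close> after a full turn; the two signs cancel.\<close>

lemma pos_seq_zeta:
  fixes Z :: "real ^ 'n::{finite,linorder} ^ 4"
  assumes Z: "maximal_minors_positive Z"
  shows "pos_seq CARD('n) (\<lambda>t. zeta Z (s + t))"
proof (induction s)
  case 0
  show ?case unfolding pos_seq_def
  proof (intro allI impI)
    fix a b c d :: nat
    assume abcd: "a < b \<and> b < c \<and> c < d \<and> d < CARD('n)"
    define k :: "4 \<Rightarrow> 'n" where
      "k s = (if s = 1 then idx a else if s = 2 then idx b else if s = 3 then idx c else idx d)" for s
    have k: "k 1 = idx a" "k 2 = idx b" "k 3 = idx c" "k 4 = idx d" by (simp_all add: k_def)
    have "0 < det (\<chi> r s. Z $ r $ k s :: real ^ 4 ^ 4)"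
      using Z abcd unfolding maximal_minors_positive_def by (simp add: k idx_less)
    also have "det (\<chi> r s. Z $ r $ k s :: real ^ 4 ^ 4)
        = br (column (idx a) Z) (column (idx b) Z) (column (idx c) Z) (column (idx d) Z)"
      unfolding det_4 br_def pairing_def wedge_nth by (simp add: k column_def algebra_simps)
    finally show "0 < br (zeta Z (0 + a)) (zeta Z (0 + b)) (zeta Z (0 + c)) (zeta Z (0 + d))"
      using abcd by (simp add: zeta_less)
  qed
next
  case (Suc s)
  show ?case unfolding pos_seq_def
  proof (intro allI impI)
    fix a b c d :: nat
    assume abcd: "a < b \<and> b < c \<and> c < d \<and> d < CARD('n)"
    show "0 < br (zeta Z (Suc s + a)) (zeta Z (Suc s + b)) (zeta Z (Suc s + c)) (zeta Z (Suc s + d))"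
    proof (cases "Suc d < CARD('n)")
      case True
      then show ?thesis using pos_seqD[OF Suc, of "Suc a" "Suc b" "Suc c" "Suc d"] abcd by simp
    next
      case False
      then have "Suc s + d = s + CARD('n)" using abcd by linarith
      then have "zeta Z (Suc s + d) = - zeta Z s" by (simp only: zeta_add_card)
      then show ?thesis using pos_seqD[OF Suc, of 0 "Suc a" "Suc b" "Suc c"] abcd
          br_rotate[of "zeta Z (Suc s + a)" "zeta Z (Suc s + b)" "zeta Z (Suc s + c)" "zeta Z s"] by simp
    qed
  qed
qed

text \<open>For pairs containing the moved point, the sign of \<open>zeta\<close> cancels against
  the exchange of the two factors.\<close>

lemma generators_zeta:
  fixes Z :: "real ^ 'n::{finite,linorder} ^ 4"
  shows "generators CARD('n) (\<lambda>t. zeta Z (s + t)) = generators CARD('n) (zeta Z)"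
proof (induction s)
  case (Suc s)
  let ?n = "CARD('n)" and ?X = "\<lambda>t. zeta Z (s + t)" and ?X' = "\<lambda>t. zeta Z (Suc s + t)"
  have last: "?X' (?n - 1) = - ?X 0" using zeta_add_card[of Z s] by (simp add: add.commute)
  have "generators ?n ?X' = generators ?n ?X"
  proof (intro equalityI subsetI)
    fix g assume "g \<in> generators ?n ?X'"
    then obtain a b where g: "g = wedge (?X' a) (?X' b)" and ab: "a < b" "b < ?n"
      unfolding generators_def by blast
    show "g \<in> generators ?n ?X"
    proof (cases "Suc b < ?n")
      case True
      then show ?thesis using generatorsI[of "Suc a" "Suc b" ?n ?X] ab g by simp
    next
      case False
      then have "b = ?n - 1" using ab by simp
      then have "g = wedge (?X 0) (?X (Suc a))"
        unfolding g \<open>b = _\<close> last using wedge_commute[of "zeta Z s" "zeta Z (s + Suc a)"] by simp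
      then show ?thesis using generatorsI[of 0 "Suc a" ?n ?X] ab by simp
    qed
  next
    fix g assume "g \<in> generators ?n ?X"
    then obtain a b where g: "g = wedge (?X a) (?X b)" and ab: "a < b" "b < ?n"
      unfolding generators_def by blast
    show "g \<in> generators ?n ?X'"
    proof (cases "a = 0")
      case False
      then show ?thesis using generatorsI[of "a - 1" "b - 1" ?n ?X'] ab g by simp
    next
      case True
      have "g = wedge (?X' (b - 1)) (?X' (?n - 1))"
        unfolding g last using ab True wedge_commute[of "zeta Z s" "zeta Z (s + b)"] by simp
      then show ?thesis using generatorsI[of "b - 1" "?n - 1" ?n ?X'] ab by simp
    qed
  qed
  then show ?case using Suc by simp
qed simp

lemma generators_columns:
  fixes Z :: "real ^ 'n::{finite,linorder} ^ 4"
  shows "generators CARD('n) (zeta Z) = {wedge (column i Z) (column j Z) | i j. i < j}"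
proof (intro equalityI subsetI)
  fix g assume "g \<in> generators CARD('n) (zeta Z)"
  then obtain a b where "g = wedge (zeta Z a) (zeta Z b)" "a < b" "b < CARD('n)"
    unfolding generators_def by blast
  then show "g \<in> {wedge (column i Z) (column j Z) | i j. i < j}"
    using idx_less[of a b, where 'n = 'n] by (auto simp: zeta_less)
next
  fix g assume "g \<in> {wedge (column i Z) (column j Z) | i j. i < j}"
  then obtain i j where g: "g = wedge (column i Z) (column j Z)" and "i < j" by blast
  obtain a b where ab: "a < CARD('n)" "idx a = i" "b < CARD('n)" "idx b = j"
    using idx_surj by meson
  then have "a < b" using \<open>i < j\<close> idx_less[of b a, where 'n = 'n] by (cases a b rule: linorder_cases) auto
  then show "g \<in> generators CARD('n) (zeta Z)"
    using generatorsI[of a b "CARD('n)" "zeta Z"] ab g by (simp add: zeta_less)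
qed

section \<open>The cone over the polytope and its facets\<close>

lemma pairing_ext_comb:
  "pairing (ext_comb Z c) L
     = (\<Sum>(i, j)\<in>{(i, j). i < j}. c i j * pairing (wedge (column i Z) (column j Z)) L)"
  unfolding ext_comb_def pairing_sum by (simp add: case_prod_beta)

lemma ext_comb_linear:
  "ext_comb Z (\<lambda>i j. s * c i j + t * d i j) = s *\<^sub>R ext_comb Z c + t *\<^sub>R ext_comb Z d"
  unfolding ext_comb_def
  by (simp add: case_prod_beta scaleR_add_left sum.distrib scaleR_sum_right)

lemma convex_ext_cyclic_cone: "convex (ext_cyclic_cone Z)"
proof (rule convexI)
  fix x y and u v :: real
  assume "x \<in> ext_cyclic_cone Z" "y \<in> ext_cyclic_cone Z" and uv: "0 \<le> u" "0 \<le> v"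
  then obtain c d where cd: "x = ext_comb Z c" "\<And>i j. i < j \<Longrightarrow> 0 \<le> c i j"
    "y = ext_comb Z d" "\<And>i j. i < j \<Longrightarrow> 0 \<le> d i j"
    unfolding ext_cyclic_cone_def by blast
  then have "u *\<^sub>R x + v *\<^sub>R y = ext_comb Z (\<lambda>i j. u * c i j + v * d i j)"
    by (simp add: ext_comb_linear)
  moreover have "0 \<le> u * c i j + v * d i j" if "i < j" for i j
    using cd uv that by simp
  ultimately show "u *\<^sub>R x + v *\<^sub>R y \<in> ext_cyclic_cone Z"
    unfolding ext_cyclic_cone_def by blast
qed

lemma zero_in_ext_cyclic_cone: "0 \<in> ext_cyclic_cone Z"
proof -
  have "ext_comb Z (\<lambda>_ _. 0) = 0" by (simp add: ext_comb_def case_prod_beta)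
  then show ?thesis unfolding ext_cyclic_cone_def by force
qed

lemma generators_subset_cone:
  fixes Z :: "real ^ 'n::{finite,linorder} ^ 4"
  shows "generators CARD('n) (zeta Z) \<subseteq> ext_cyclic_cone Z"
proof
  fix g assume "g \<in> generators CARD('n) (zeta Z)"
  then obtain i j where g: "g = wedge (column i Z) (column j Z)" and ij: "i < j"
    unfolding generators_columns by blast
  define c :: "'n \<Rightarrow> 'n \<Rightarrow> real" where "c k l = (if (k, l) = (i, j) then 1 else 0)" for k l
  have "ext_comb Z c = (\<Sum>p\<in>{(i, j). i < j}. if p = (i, j) then g else 0)"
    unfolding ext_comb_def by (intro sum.cong) (auto simp: c_def g split: if_splits)
  also have "\<dots> = g" using ij by (subst sum.delta) auto
  finally show "g \<in> ext_cyclic_cone Z"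
    unfolding ext_cyclic_cone_def by (auto simp: c_def intro!: exI[of _ c])
qed

lemma pairing_cone_nonneg:
  fixes Z :: "real ^ 'n::{finite,linorder} ^ 4"
  assumes "\<forall>g\<in>generators CARD('n) (zeta Z). 0 \<le> pairing g L" and "Y \<in> ext_cyclic_cone Z"
  shows "0 \<le> pairing Y L"
proof -
  obtain c where "Y = ext_comb Z c" "\<And>i j. i < j \<Longrightarrow> 0 \<le> c i j"
    using assms(2) unfolding ext_cyclic_cone_def by blast
  moreover have "0 \<le> pairing (wedge (column i Z) (column j Z)) L" if "i < j" for i j
    using assms(1) that unfolding generators_columns by blast
  ultimately show ?thesis
    by (auto simp: pairing_ext_comb intro!: sum_nonneg mult_nonneg_nonneg)
qed

text \<open>The Hodge star of the oriented Euclidean 4-space. It turns the pairing into the inner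
  product, in whose terms faces and normal vectors are available.\<close>

definition hodge :: "bivector \<Rightarrow> bivector" where
  "hodge L = vector [L$6, - L$5, L$4, L$3, - L$2, L$1]"

lemma hodge_nth:
  "hodge L $ 1 = L$6" "hodge L $ 2 = - L$5" "hodge L $ 3 = L$4"
  "hodge L $ 4 = L$3" "hodge L $ 5 = - L$2" "hodge L $ 6 = L$1"
  unfolding hodge_def vector_def by simp_all

lemma inner_hodge: "hodge L \<bullet> Y = pairing Y L"
  by (simp add: inner_vec_def sum_6 hodge_nth pairing_def mult.commute)

lemma pairing_hodge: "pairing Y (hodge a) = a \<bullet> Y"
  by (simp add: inner_vec_def sum_6 hodge_nth pairing_def mult.commute)

text \<open>If the face together with a generator \<open>g\<close> off the hyperplane did not span,
  a common normal vector would give a functional vanishing on all generators in the face, hence a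
  multiple of \<open>L\<close>. Vanishing on \<open>g\<close> makes that multiple zero.\<close>

lemma supports_facet_if_facet_functional:
  fixes Z :: "real ^ 'n::{finite,linorder} ^ 4"
  assumes L: "facet_functional (generators CARD('n) (zeta Z)) L"
  shows "supports_facet Z L (ext_cyclic_cone Z \<inter> {Y. pairing Y L = 0})" (is "supports_facet Z L ?F")
proof -
  let ?G = "generators CARD('n) (zeta Z)" and ?S = "ext_cyclic_cone Z"
  have nonneg: "\<forall>Y\<in>?S. 0 \<le> pairing Y L"
    using L pairing_cone_nonneg unfolding facet_functional_def by blast
  obtain g where g: "g \<in> ?G" "pairing g L \<noteq> 0" using L unfolding facet_functional_def by blast
  have face: "?F face_of ?S"
    using face_of_Int_supporting_hyperplane_ge[OF convex_ext_cyclic_cone, of Z 0 "hodge L"] nonneg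
    by (simp add: inner_hodge)
  have F0: "0 \<in> ?F" using zero_in_ext_cyclic_cone by simp
  have "dim (insert g ?F) = DIM(bivector)"
  proof (rule ccontr)
    assume "dim (insert g ?F) \<noteq> DIM(bivector)"
    then have "dim (insert g ?F) < DIM(bivector)" using dim_subset_UNIV le_neq_implies_less by blast
    then obtain a where a: "a \<noteq> 0" "span (insert g ?F) \<subseteq> {x. a \<bullet> x = 0}"
      using lowdim_subset_hyperplane by blast
    then have orth: "pairing Y (hodge a) = 0" if "Y \<in> insert g ?F" for Y
      using that span_base[of Y "insert g ?F"] unfolding pairing_hodge by blast
    have "\<forall>h\<in>?G. pairing h L = 0 \<longrightarrow> pairing h (hodge a) = 0"
      using orth generators_subset_cone[of Z] by blast
    then obtain t where t: "hodge a = t *\<^sub>R L" using L unfolding facet_functional_def by blast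
    then have "t = 0" using orth[of g] g by simp
    then have "a \<bullet> a = 0" using t pairing_hodge[of a a] by simp
    then show False using a by simp
  qed
  \<comment> \<open>The face has dimension at least 5 and is a proper face of a cone of dimension at
    most 6. It contains 0, so linear and affine dimension agree.\<close>
  moreover have "dim (insert g ?F) \<le> dim ?F + 1" by (simp add: dim_insert)
  ultimately have "int DIM(bivector) - 1 \<le> aff_dim ?F"
    using aff_dim_zero[of ?F] F0 hull_inc[of 0 ?F] by simp
  moreover have "aff_dim ?F < aff_dim ?S"
    using face_of_aff_dim_lt[OF convex_ext_cyclic_cone face] g generators_subset_cone[of Z] by blast
  moreover have "aff_dim ?S \<le> int DIM(bivector)" by (rule aff_dim_le_DIM)
  ultimately have "aff_dim ?F = aff_dim ?S - 1" by linarith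
  then show ?thesis unfolding supports_facet_def facet_of_def using face F0 nonneg by blast
qed

lemma schubert_inequality:
  fixes Z :: "real ^ 'n::{finite,linorder} ^ 4"
  assumes "facet_functional (generators CARD('n) (zeta Z)) L" and "decomposable L"
    and "\<forall>F L. schubert_facet Z F \<and> supports_facet Z L F \<longrightarrow> 0 \<le> pairing Y L"
  shows "0 \<le> pairing Y L"
  using assms supports_facet_if_facet_functional schubert_facet_def by blast

section \<open>Representing a line by a non-negative matrix\<close>

text \<open>Quantifying over all alternating forms gives at once the non-negativity of the minors and, through a
  functional that is positive on the cone, that the two images are independent.\<close>

definition window_positive ::
    "nat \<Rightarrow> real ^ 'n::{finite,linorder} \<Rightarrow> real ^ 'n::{finite,linorder} \<Rightarrow> bool" where
  "window_positive s x y \<longleftrightarrow> (\<forall>f :: real ^ 'n::{finite,linorder} \<Rightarrow> real ^ 'n::{finite,linorder} \<Rightarrow> real.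
     bilinear f \<longrightarrow> (\<forall>x. f x x = 0) \<longrightarrow>
     ((\<forall>a b. a < b \<longrightarrow> b < CARD('n) \<longrightarrow> 0 \<le> f (sunit (s + a)) (sunit (s + b))) \<longrightarrow> 0 \<le> f x y) \<and>
     ((\<forall>a b. a < b \<longrightarrow> b < CARD('n) \<longrightarrow> 0 < f (sunit (s + a)) (sunit (s + b))) \<longrightarrow> 0 < f x y))"

text \<open>A single lower bound by a positive multiple of the form on one pair of the window yields
  the weak and the strict clause together.\<close>

lemma window_positiveI:
  fixes x y :: "real ^ 'n::{finite,linorder}"
  assumes "a < b" "b < CARD('n)" "0 < t"
    and "\<And>f :: real ^ 'n::{finite,linorder} \<Rightarrow> real ^ 'n::{finite,linorder} \<Rightarrow> real. bilinear f \<Longrightarrow> (\<And>x. f x x = 0) \<Longrightarrow>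
      (\<And>a b. a < b \<Longrightarrow> b < CARD('n) \<Longrightarrow> 0 \<le> f (sunit (s + a)) (sunit (s + b))) \<Longrightarrow>
      t * f (sunit (s + a)) (sunit (s + b)) \<le> f x y"
  shows "window_positive s x y"
  unfolding window_positive_def
proof (intro allI impI conjI)
  fix f :: "real ^ 'n::{finite,linorder} \<Rightarrow> real ^ 'n::{finite,linorder} \<Rightarrow> real"
  assume f: "bilinear f" "\<forall>x. f x x = 0"
  show "0 \<le> f x y"
    if "\<forall>a b. a < b \<longrightarrow> b < CARD('n) \<longrightarrow> 0 \<le> f (sunit (s + a)) (sunit (s + b))"
  proof -
    have "0 \<le> t * f (sunit (s + a)) (sunit (s + b))" using that assms(1-3) by simp
    also have "\<dots> \<le> f x y" using f that by (intro assms(4)) blast+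
    finally show ?thesis .
  qed
  show "0 < f x y"
    if pos: "\<forall>a b. a < b \<longrightarrow> b < CARD('n) \<longrightarrow> 0 < f (sunit (s + a)) (sunit (s + b))"
  proof -
    have "0 < t * f (sunit (s + a)) (sunit (s + b))" using pos assms(1-3) by simp
    also have "\<dots> \<le> f x y" using f pos by (intro assms(4)) (blast intro: less_imp_le)+
    finally show ?thesis .
  qed
qed

lemma bilinear_form_simps:
  fixes f :: "'a::real_vector \<Rightarrow> 'a \<Rightarrow> real"
  assumes "bilinear f"
  shows "f (x + y) z = f x z + f y z" "f z (x + y) = f z x + f z y"
    "f (t *\<^sub>R x) z = t * f x z" "f z (t *\<^sub>R x) = t * f z x"
  using bilinear_ladd[OF assms] bilinear_radd[OF assms] bilinear_lmul[OF assms] bilinear_rmul[OF assms]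
  by simp_all

text \<open>In the physics literature the matrices with these two rows form a kermit cell.\<close>

lemma window_positive_kermit:
  fixes s k l :: nat
  defines "e \<equiv> \<lambda>a. sunit (s + a) :: real ^ 'n::{finite,linorder}"
  assumes kl: "0 < k" "k < l" "l + 1 < CARD('n)"
    and coeff: "0 \<le> \<gamma>" "0 < c" "0 \<le> c'" "0 \<le> \<delta>" "0 \<le> d" "0 < d'"
  shows "window_positive s (\<gamma> *\<^sub>R e 0 + c *\<^sub>R e k + c' *\<^sub>R e (k + 1))
     ((- \<delta>) *\<^sub>R e 0 + d *\<^sub>R e l + d' *\<^sub>R e (l + 1))"
proof (rule window_positiveI[of k "l + 1" "c * d'"])
  show "k < l + 1" "l + 1 < CARD('n)" "0 < c * d'" using kl coeff by auto
  fix f :: "real ^ 'n::{finite,linorder} \<Rightarrow> real ^ 'n::{finite,linorder} \<Rightarrow> real"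
  assume f: "bilinear f" and same: "\<And>x. f x x = 0"
    and pos: "\<And>a b. a < b \<Longrightarrow> b < CARD('n) \<Longrightarrow> 0 \<le> f (sunit (s + a)) (sunit (s + b))"
  have swap: "f y x = - f x y" for x y
    using same[of "x + y"] same[of x] same[of y] unfolding bilinear_form_simps[OF f] by linarith
  have e: "sunit (s + a) = e a" for a by (simp add: e_def)
  have nn: "0 \<le> f (e a) (e b)" if "a \<le> b" "b < CARD('n)" for a b
    using pos[of a b] that same by (cases "a = b") (auto simp: e_def)
  \<comment> \<open>These are the other terms of the expanded form. The negative coefficient of
    \<open>e 0\<close> in the second row is compensated by exchanging it with \<open>e k\<close> and
    \<open>e (k + 1)\<close>.\<close>
  have "0 \<le> \<gamma> * d * f (e 0) (e l) + \<gamma> * d' * f (e 0) (e (l + 1)) + c * \<delta> * f (e 0) (e k)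
      + c' * \<delta> * f (e 0) (e (k + 1)) + c * d * f (e k) (e l)
      + c' * d * f (e (k + 1)) (e l) + c' * d' * f (e (k + 1)) (e (l + 1))"
    using kl coeff by (intro add_nonneg_nonneg mult_nonneg_nonneg nn) auto
  then show "c * d' * f (sunit (s + k)) (sunit (s + (l + 1)))
      \<le> f (\<gamma> *\<^sub>R e 0 + c *\<^sub>R e k + c' *\<^sub>R e (k + 1)) ((- \<delta>) *\<^sub>R e 0 + d *\<^sub>R e l + d' *\<^sub>R e (l + 1))"
    unfolding e bilinear_form_simps[OF f] same swap[of "e k" "e 0"] swap[of "e (k + 1)" "e 0"]
    by (simp add: algebra_simps)
qed

text \<open>A fixed minor is an alternating form. It is non-negative on every window, by the same
  cancellation of signs as in \<open>pos_seq_zeta\<close>.\<close>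

lemma nonneg_minors_if_window_positive:
  fixes x y :: "real ^ 'n::{finite,linorder}"
  assumes "window_positive s x y" "i < j"
  shows "0 \<le> x $ i * y $ j - x $ j * y $ i"
proof -
  let ?f = "\<lambda>x y :: real ^ 'n::{finite,linorder}. x $ i * y $ j - x $ j * y $ i"
  have sunit: "0 \<le> ?f (sunit (s + a)) (sunit (s + b))" if "a < b" "b < CARD('n)" for s a b
    using that
  proof (induction s arbitrary: a b)
    case 0
    have "idx a < (idx b :: 'n)" using 0 by (rule idx_less)
    then show ?case using 0 \<open>i < j\<close> by (auto simp: sunit_less axis_def)
  next
    case (Suc s)
    show ?case
    proof (cases "Suc b < CARD('n)")
      case True
      then show ?thesis using Suc.IH[of "Suc a" "Suc b"] Suc.prems by simp
    next
      case False
      then have "Suc s + b = s + CARD('n)" using Suc.prems by linarith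
      then have "sunit (Suc s + b) = - (sunit s :: real ^ 'n::{finite,linorder})" by (simp only: sunit_add_card)
      then show ?thesis using Suc.IH[of 0 "Suc a"] Suc.prems by (simp add: mult.commute)
    qed
  qed
  have "bilinear ?f"
    unfolding bilinear_def linear_iff by (simp add: algebra_simps)
  moreover have "?f x x = 0" for x by simp
  ultimately show ?thesis
    using assms(1) sunit unfolding window_positive_def by (elim allE[of _ ?f]) simp
qed

text \<open>The alternating form to use is the pairing of the wedge of the images with a strictly
  positive functional.\<close>

lemma wedge_nonzero_if_window_positive:
  fixes Z :: "real ^ 'n::{finite,linorder} ^ 4"
  assumes Z: "maximal_minors_positive Z" "4 \<le> CARD('n)" and xy: "window_positive s x y"
  shows "wedge (Z *v x) (Z *v y) \<noteq> 0"
proof -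
  obtain L where L: "\<forall>g\<in>generators CARD('n) (\<lambda>t. zeta Z (s + t)). 0 < pairing g L"
    using ex_positive_functional[OF pos_seq_zeta[OF Z(1)] Z(2)] by blast
  let ?f = "\<lambda>x y. pairing (wedge (Z *v x) (Z *v y)) L"
  have "bilinear ?f"
    unfolding bilinear_def linear_iff
    by (simp add: matrix_vector_right_distrib matrix_vector_mult_scaleR)
  moreover have "?f x x = 0" for x by simp
  moreover have "0 < ?f (sunit (s + a)) (sunit (s + b))" if "a < b" "b < CARD('n)" for a b
    using L generatorsI[OF that, of "\<lambda>t. zeta Z (s + t)"] unfolding zeta_def by blast
  ultimately have "0 < ?f x y" using xy unfolding window_positive_def by blast
  then show ?thesis by auto
qed

section \<open>Lines satisfying the Schubert inequalities\<close>

text \<open>The variables \<open>s\<close> and \<open>j\<close> are universally quantified, so the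
  edge and plane-meet inequalities are assumed in every window.\<close>

locale schubert_line =
  fixes Z :: "real ^ 'n::{finite,linorder} ^ 4" and u v :: "real ^ 4"
  assumes card: "4 \<le> CARD('n)" and Z: "maximal_minors_positive Z" and uv: "wedge u v \<noteq> 0"
    and edge: "0 \<le> pairing (wedge u v) (wedge (zeta Z s) (zeta Z (s + 1)))"
    and meet: "2 \<le> j \<Longrightarrow> j \<le> CARD('n) - 2 \<Longrightarrow> 0 \<le> pairing (wedge u v)
      (plane_meet (zeta Z s) (zeta Z (s + 1)) (zeta Z (s + (CARD('n) - 1)))
        (zeta Z (s + (j - 1))) (zeta Z (s + j)) (zeta Z (s + (j + 1))))"
begin

definition B :: "nat \<Rightarrow> nat \<Rightarrow> real" where
  "B a b = br u v (zeta Z a) (zeta Z b)"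

definition F :: "nat \<Rightarrow> nat \<Rightarrow> real" where
  "F s x = br (zeta Z s) (zeta Z (s + 1)) (zeta Z (s + x)) (zeta Z (s + (CARD('n) - 1)))"

definition maps_into_plane :: "real ^ 'n::{finite,linorder} \<Rightarrow> bool" where
  "maps_into_plane x \<longleftrightarrow> Z *v x \<in> span {u, v}"

lemma B_same [simp]: "B a a = 0"
  unfolding B_def by simp

text \<open>The sign of \<open>zeta\<close> after a full turn becomes an exchange of arguments by
  antisymmetry.\<close>

lemma B_add_card: "B a (b + CARD('n)) = B b a" "B (a + CARD('n)) b = B b a"
  unfolding B_def zeta_add_card using br_swap(3)[of u v "zeta Z b" "zeta Z a"] by simp_all

lemma B_edge: "0 \<le> B s (s + 1)"
  using edge[of s] unfolding B_def br_def .

text \<open>The closing edge of a window is an ordinary edge of the continued sequence.\<close>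

lemma B_edge_wrap: "0 \<le> B s (s + (CARD('n) - 1))"
proof -
  have "0 \<le> B (s + (CARD('n) - 1)) (s + CARD('n))"
    using B_edge[of "s + (CARD('n) - 1)"] card by simp
  then show ?thesis unfolding B_add_card .
qed

text \<open>Where the three values of \<open>F\<close> are positive, division by their product shows
  the meaning: the polygon of the images divided by \<open>F\<close> does not turn right at the
  vertex \<open>j\<close>.\<close>

lemma B_meet:
  assumes "2 \<le> j" "j \<le> CARD('n) - 2"
  shows "F s j * B (s + (j - 1)) (s + (j + 1))
    \<le> F s (j - 1) * B (s + j) (s + (j + 1)) + F s (j + 1) * B (s + (j - 1)) (s + j)"
  using meet[OF assms, of s] unfolding plane_meet_def F_def B_def br_def by simp

lemma B_plucker: "B x z * B y w = B x y * B z w + B x w * B y z"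
  unfolding B_def by (rule plucker_relation)

lemma F_pos: "1 < x \<Longrightarrow> x < CARD('n) - 1 \<Longrightarrow> 0 < F s x"
  unfolding F_def using pos_seqD[OF pos_seq_zeta[OF Z, of s], of 0 1 x "CARD('n) - 1"] by simp

lemma F_zero [simp]: "F s 0 = 0" "F s (Suc 0) = 0" "F s (CARD('n) - Suc 0) = 0"
  unfolding F_def by simp_all

lemma triangle_in_span:
  "B b c *\<^sub>R zeta Z a - B a c *\<^sub>R zeta Z b + B a b *\<^sub>R zeta Z c \<in> span {u, v}"
  unfolding B_def five_vector_relation
  by (intro span_diff span_scale span_base) auto

text \<open>Otherwise \<open>wedge u v\<close> would be zero by its expansion in four consecutive
  points.\<close>

lemma ex_B_nonzero: "\<exists>b<CARD('n). \<exists>c<CARD('n). B (s + b) (s + c) \<noteq> 0"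
proof (rule ccontr)
  assume "\<not> ?thesis"
  then have zero: "pairing (wedge u v) (wedge (zeta Z (s + b)) (zeta Z (s + c))) = 0" if "b < 4" "c < 4" for b c
    using that card unfolding B_def br_def by simp
  have "0 < br (zeta Z (s + 0)) (zeta Z (s + 1)) (zeta Z (s + 2)) (zeta Z (s + 3))"
    using pos_seqD[OF pos_seq_zeta[OF Z, of s], of 0 1 2 3] card by simp
  moreover have "br (zeta Z (s + 0)) (zeta Z (s + 1)) (zeta Z (s + 2)) (zeta Z (s + 3)) *\<^sub>R wedge u v = 0"
    unfolding bivector_basis_expansion by (simp only: zero) simp
  ultimately show False using uv by simp
qed

text \<open>The image in the quotient plane is zero. Testing against one window is enough, since all
  others repeat it up to sign.\<close>

definition vanishes :: "nat \<Rightarrow> bool" where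
  "vanishes a \<longleftrightarrow> (\<forall>t<CARD('n). B a (a + t) = 0)"

lemma vanishes_in_span:
  assumes "vanishes a"
  shows "zeta Z a \<in> span {u, v}"
proof -
  obtain b c where bc: "b < CARD('n)" "c < CARD('n)" "B (a + b) (a + c) \<noteq> 0" using ex_B_nonzero by blast
  then have "B (a + b) (a + c) *\<^sub>R zeta Z a \<in> span {u, v}"
    using triangle_in_span[of "a + b" "a + c" a] assms unfolding vanishes_def by simp
  then have "(1 / B (a + b) (a + c)) *\<^sub>R B (a + b) (a + c) *\<^sub>R zeta Z a \<in> span {u, v}"
    by (rule span_scale)
  then show ?thesis using bc by simp
qed

lemma realize_sign_flips:
  assumes t: "0 < t" "t < CARD('n)" and neg: "B s (s + t) < 0"
  shows "\<exists>x y. maps_into_plane x \<and> maps_into_plane y \<and> window_positive s x y"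
proof -
  let ?b = "\<lambda>k. B s (s + k)"
  \<comment> \<open>The first sign change, from \<open>k\<close> to \<open>k' = k + 1\<close>. The
    edge inequality excludes \<open>k' = 1\<close>, so \<open>k\<close> is positive.\<close>
  define k' where "k' = (LEAST k. 0 < k \<and> ?b k < 0)"
  have k': "0 < k'" "?b k' < 0" "k' \<le> t"
    using LeastI[of "\<lambda>k. 0 < k \<and> ?b k < 0" t] Least_le[of "\<lambda>k. 0 < k \<and> ?b k < 0" t] t neg
    unfolding k'_def by auto
  have "k' \<noteq> 1" using k'(2) B_edge[of s] by auto
  define k where "k = k' - 1"
  have k: "0 < k" "k + 1 = k'" using k' \<open>k' \<noteq> 1\<close> by (auto simp: k_def)
  have bk: "0 \<le> ?b k"
    using not_less_Least[of k "\<lambda>k. 0 < k \<and> ?b k < 0"] k unfolding k'_def[symmetric] by auto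
  define l' where "l' = (LEAST l. t < l \<and> 0 \<le> ?b l)"
  \<comment> \<open>The closing edge provides a non-negative value after \<open>t\<close>, so a
    second sign change exists, from \<open>l\<close> to \<open>l' = l + 1\<close>.\<close>
  have "t \<noteq> CARD('n) - 1" using neg B_edge_wrap[of s] by auto
  then have lst: "t < CARD('n) - 1 \<and> 0 \<le> ?b (CARD('n) - 1)" using t B_edge_wrap[of s] by auto
  have l': "t < l'" "0 \<le> ?b l'" "l' \<le> CARD('n) - 1"
    using LeastI[of "\<lambda>l. t < l \<and> 0 \<le> ?b l", OF lst] Least_le[of "\<lambda>l. t < l \<and> 0 \<le> ?b l", OF lst]
    unfolding l'_def by auto
  define l where "l = l' - 1"
  have l: "t \<le> l" "l + 1 = l'" "l + 1 < CARD('n)" using l' card by (auto simp: l_def)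
  have bl: "?b l < 0"
  proof (cases "l = t")
    case False
    then show ?thesis
      using not_less_Least[of l "\<lambda>l. t < l \<and> 0 \<le> ?b l"] l unfolding l'_def[symmetric] by auto
  qed (use neg in simp)
  \<comment> \<open>Each row is the relation of \<open>triangle_in_span\<close> between
    \<open>s\<close> and the two points at a sign change, negated for \<open>y\<close>. The signs of
    the coefficients are then those of \<open>window_positive_kermit\<close>.\<close>
  define x :: "real ^ 'n::{finite,linorder}" where "x = B (s + k) (s + (k + 1)) *\<^sub>R sunit (s + 0) + (- ?b (k + 1)) *\<^sub>R sunit (s + k)
    + ?b k *\<^sub>R sunit (s + (k + 1))"
  define y :: "real ^ 'n::{finite,linorder}" where "y = (- B (s + l) (s + (l + 1))) *\<^sub>R sunit (s + 0) + ?b (l + 1) *\<^sub>R sunit (s + l)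
    + (- ?b l) *\<^sub>R sunit (s + (l + 1))"
  note mult = matrix_vector_right_distrib matrix_vector_mult_scaleR
  have "maps_into_plane x"
    using triangle_in_span[of "s + k" "s + (k + 1)" s] unfolding maps_into_plane_def x_def mult zeta_def by simp
  moreover have "maps_into_plane y"
    using span_neg[OF triangle_in_span[of "s + l" "s + (l + 1)" s]]
    unfolding maps_into_plane_def y_def mult zeta_def by (simp add: algebra_simps)
  moreover have "window_positive s x y"
    unfolding x_def y_def
    by (rule window_positive_kermit) (use k k' l l' bk bl t B_edge[of "s + k"] B_edge[of "s + l"] in auto)
  ultimately show ?thesis by blast
qed

text \<open>In \<open>B_meet\<close> with \<open>j = 2\<close> one term on the right contains
  \<open>F s 1 = 0\<close> and the other the assumed zero.\<close>

lemma B_next_zero: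
  assumes "B (s + 1) (s + 2) = 0"
  shows "B (s + 1) (s + 3) \<le> 0"
proof -
  have "F s 2 * B (s + 1) (s + 3) \<le> 0"
    using B_meet[of 2 s] card assms by (simp add: numeral_3_eq_3)
  moreover have "0 < F s 2" by (rule F_pos) (use card in auto)
  ultimately show ?thesis by (auto simp: mult_le_0_iff)
qed

lemma B_next_zero': "0 < a \<Longrightarrow> B a (a + 1) = 0 \<Longrightarrow> B a (a + 2) \<le> 0"
  using B_next_zero[of "a - 1"] by simp

text \<open>One row is the unit vector at \<open>a\<close>. If the next point does not vanish too,
  the two neighbours of \<open>a\<close> have dependent images, and a non-negative combination of
  them lies in the plane and gives the other row.\<close>

lemma realize_vanishing:
  assumes nonneg: "\<And>s t. 0 < t \<Longrightarrow> t < CARD('n) \<Longrightarrow> 0 \<le> B s (s + t)" and a: "vanishes a"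
  shows "\<exists>x y. maps_into_plane x \<and> maps_into_plane y \<and> window_positive a x y"
proof (cases "vanishes (a + 1)")
  case True
  have "maps_into_plane (sunit a)" "maps_into_plane (sunit (a + 1))"
    using vanishes_in_span a True unfolding maps_into_plane_def zeta_def by auto
  moreover have "window_positive a (sunit a) (sunit (a + 1) :: real ^ 'n::{finite,linorder})"
    by (rule window_positiveI[of 0 1 1]) (use card in auto)
  ultimately show ?thesis by blast
next
  case False
  let ?n = "CARD('n)"
  have a0: "B a (a + 1) = 0" "B (a + (?n - 1)) (a + ?n) = 0"
    using a[unfolded vanishes_def, rule_format, of 1] a[unfolded vanishes_def, rule_format, of "?n - 1"]
      card unfolding B_add_card by simp_all
  \<comment> \<open>\<open>B_next_zero'\<close> at the predecessor of \<open>a + n\<close> compares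
    the two neighbours of \<open>a\<close>; \<open>nonneg\<close> gives the opposite
    inequality.\<close>
  have "B (a + (?n - 1)) (a + (?n - 1) + 2) \<le> 0"
    using B_next_zero'[of "a + (?n - 1)"] a0(2) card by simp
  moreover have "a + (?n - 1) + 2 = (a + 1) + ?n" using card by simp
  ultimately have "B (a + 1) (a + (?n - 1)) \<le> 0" by (simp only: B_add_card)
  moreover have "a + (?n - 1) = a + 1 + (?n - 2)" using card by simp
  ultimately have opp: "B (a + 1) (a + (?n - 1)) = 0"
    using nonneg[of "?n - 2" "a + 1"] card by simp
  \<comment> \<open>The image of this third point is independent of that of \<open>a + 1\<close>.
    The exclusions that follow put it strictly between the two neighbours, where
    \<open>nonneg\<close> fixes the signs of \<open>\<alpha>\<close> and
    \<open>\<beta>\<close>.\<close>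
  obtain t where t: "t < ?n" "B (a + 1) (a + 1 + t) \<noteq> 0" using False unfolding vanishes_def by blast
  have "t \<noteq> 0" using t(2) by (metis B_same add_0_right)
  moreover have "t \<noteq> ?n - 1"
  proof
    assume "t = ?n - 1"
    then have "a + 1 + t = a + ?n" using card by simp
    then show False using t(2) a0(1) by (simp only: B_add_card)
  qed
  moreover have "t \<noteq> ?n - 2"
  proof
    assume "t = ?n - 2"
    then have "a + 1 + t = a + (?n - 1)" using card by simp
    then show False using t(2) opp by simp
  qed
  ultimately have tb: "0 < t" "t < ?n - 2" using t by auto
  define \<alpha> \<beta> where "\<alpha> = B (a + 1 + t) (a + (?n - 1))" and "\<beta> = B (a + 1) (a + 1 + t)"
  have \<beta>: "0 < \<beta>" using nonneg[of t "a + 1"] t tb unfolding \<beta>_def by simp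
  have "a + (?n - 1) = a + 1 + t + (?n - 2 - t)" using tb by simp
  then have \<alpha>: "0 \<le> \<alpha>" using nonneg[of "?n - 2 - t" "a + 1 + t"] tb unfolding \<alpha>_def by simp
  define y :: "real ^ 'n::{finite,linorder}" where "y = \<alpha> *\<^sub>R sunit (a + 1) + \<beta> *\<^sub>R sunit (a + (?n - 1))"
  have "maps_into_plane (sunit a)" using vanishes_in_span a unfolding maps_into_plane_def zeta_def by auto
  moreover have "maps_into_plane y"
    using triangle_in_span[of "a + 1 + t" "a + (?n - 1)" "a + 1"]
    unfolding maps_into_plane_def y_def matrix_vector_right_distrib matrix_vector_mult_scaleR
      opp \<alpha>_def \<beta>_def zeta_def by simp
  moreover have "window_positive a (sunit a) y"
  proof (rule window_positiveI[of 0 "?n - 1" \<beta>])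
    fix f :: "real ^ 'n::{finite,linorder} \<Rightarrow> real ^ 'n::{finite,linorder} \<Rightarrow> real"
    assume f: "bilinear f" and "\<And>a' b. a' < b \<Longrightarrow> b < ?n \<Longrightarrow> 0 \<le> f (sunit (a + a')) (sunit (a + b))"
    from this(2)[of 0 1] have "0 \<le> \<alpha> * f (sunit a) (sunit (a + 1))" using \<alpha> card by simp
    then show "\<beta> * f (sunit (a + 0)) (sunit (a + (?n - 1))) \<le> f (sunit a) y"
      unfolding y_def by (simp add: bilinear_form_simps[OF f])
  qed (use card \<beta> in auto)
  ultimately show ?thesis by blast
qed

lemma ex_vanishing:
  assumes nonneg: "\<And>s t. 0 < t \<Longrightarrow> t < CARD('n) \<Longrightarrow> 0 \<le> B s (s + t)"
  shows "\<exists>a. vanishes a"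
proof (rule ccontr)
  assume "\<nexists>a. vanishes a"
  then have nz: "\<exists>w. B a w \<noteq> 0" for a unfolding vanishes_def by blast
  let ?n = "CARD('n)"
  have edge_pos: "0 < B k (k + 1)" if "0 < k" for k
  proof (rule ccontr)
    assume "\<not> 0 < B k (k + 1)"
    then have start: "B k (k + 1) = 0" using B_edge[of k] by simp
    \<comment> \<open>A zero edge propagates: by \<open>B_next_zero'\<close> and
      \<open>nonneg\<close> two further values vanish in turn, so all later images are parallel to
      that of \<open>k\<close>, and \<open>k\<close> vanishes.\<close>
    have adj: "B (k + m) (k + m + 1) = 0" for m
    proof (induction m)
      case (Suc m)
      have "B (k + m) (k + m + 2) = 0"
        using B_next_zero'[of "k + m"] nonneg[of 2 "k + m"] Suc that card by simp
      moreover obtain w where "B (k + m) w \<noteq> 0" using nz by blast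
      ultimately show ?case
        using B_plucker[of "k + m" w "k + m + 1" "k + m + 2"] Suc by simp
    qed (use start in simp)
    have "B k (k + t) = 0" for t
    proof (induction t)
      case (Suc t)
      obtain w where "B (k + t) w \<noteq> 0" using nz by blast
      then show ?case using B_plucker[of k "k + t + 1" "k + t" w] Suc adj[of t] by simp
    qed simp
    then have "vanishes k" unfolding vanishes_def by blast
    then show False using \<open>\<nexists>a. vanishes a\<close> by blast
  qed
  \<comment> \<open>The window starts at 1 because \<open>edge_pos\<close> needs a positive
    index.\<close>
  define s :: nat where "s = 1"
  define b where "b i j = B (s + i) (s + j)" for i j
  have bpos: "0 < b j (j + 1)" for j using edge_pos[of "s + j"] by (simp add: b_def s_def)
  have bnn: "0 \<le> b i j" if "i < j" "j < i + ?n" for i j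
    using nonneg[of "j - i" "s + i"] that unfolding b_def by simp
  \<comment> \<open>As \<open>F s 1 = 0\<close>, the polygon comes in from infinity in the direction
    of the image of \<open>s + 1\<close>. Where \<open>F\<close> is positive, the inequality says
    that the determinant of this direction with the vertex \<open>j\<close> does not increase along
    the polygon.\<close>
  have E: "0 \<le> F s (j + 1) * b 1 j - F s j * b 1 (j + 1)" if "1 \<le> j" "j \<le> ?n - 2" for j
    using that
  proof (induction j rule: dec_induct)
    case base
    show ?case by (simp add: b_def)
  next
    case (step j)
    let ?E = "\<lambda>j. F s (j + 1) * b 1 j - F s j * b 1 (j + 1)"
    \<comment> \<open>\<open>?D\<close> is the turn at the vertex \<open>j + 1\<close>. The Pluecker
      relation identifies \<open>?E (j + 1) * b j (j + 1)\<close> with a non-negative combination of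
      \<open>?E j\<close> and \<open>?D\<close>.\<close>
    let ?D = "F s j * b (j + 1) (j + 2) + F s (j + 2) * b j (j + 1) - F s (j + 1) * b j (j + 2)"
    have "0 \<le> ?D" using B_meet[of "j + 1" s] step unfolding b_def by simp
    moreover have "0 \<le> b 1 (j + 1)" using bnn[of 1 "j + 1"] step by simp
    ultimately have "0 \<le> ?E j * b (j + 1) (j + 2) + ?D * b 1 (j + 1)"
      using step bpos[of "j + 1"] by simp
    also have "\<dots> = F s (j + 2) * b 1 (j + 1) * b j (j + 1)
        + F s (j + 1) * (b 1 j * b (j + 1) (j + 2) - b 1 (j + 1) * b j (j + 2))"
      by (simp add: algebra_simps)
    also have "\<dots> = ?E (j + 1) * b j (j + 1)"
      using B_plucker[of "s + 1" "s + (j + 1)" "s + j" "s + (j + 2)"] unfolding b_def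
      by (simp add: algebra_simps)
    finally show ?case using bpos[of j] by (simp add: zero_le_mult_iff)
  qed
  \<comment> \<open>The last \<open>F\<close> vanishes too: the polygon leaves to infinity, and the
    bound there forces \<open>b 1 (n - 1) = 0\<close>.\<close>
  have "0 \<le> - (F s (?n - 2) * b 1 (?n - 1))"
    using E[of "?n - 2"] card by (simp add: Suc_diff_Suc numeral_2_eq_2)
  moreover have "0 < F s (?n - 2)" by (rule F_pos) (use card in auto)
  ultimately have "b 1 (?n - 1) \<le> 0" by (auto simp: mult_le_0_iff)
  then have "b 1 (?n - 1) = 0" using bnn[of 1 "?n - 1"] card by simp
  \<comment> \<open>The Pluecker relation of the points 1, 2, \<open>n - 1\<close>, \<open>n\<close>
    of the window now equates zero with a positive number.\<close>
  then have "0 = b 1 2 * b (?n - 1) ?n + b 1 ?n * b 2 (?n - 1)"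
    using B_plucker[of "s + 1" "s + (?n - 1)" "s + 2" "s + ?n"] unfolding b_def by simp
  moreover have "0 < b 1 2 * b (?n - 1) ?n" using bpos[of 1] bpos[of "?n - 1"] card
    by (simp add: numeral_2_eq_2)
  moreover have "0 \<le> b 1 ?n * b 2 (?n - 1)" using card by (intro mult_nonneg_nonneg bnn) auto
  ultimately show False by linarith
qed

lemma realizable:
  "\<exists>x y. Z *v x \<in> span {u, v} \<and> Z *v y \<in> span {u, v} \<and> wedge (Z *v x) (Z *v y) \<noteq> 0 \<and>
     (\<forall>i j. i < j \<longrightarrow> 0 \<le> x $ i * y $ j - x $ j * y $ i)"
proof -
  have "\<exists>s x y. maps_into_plane x \<and> maps_into_plane y \<and> window_positive s x y"
  proof (cases "\<forall>s t. 0 < t \<longrightarrow> t < CARD('n) \<longrightarrow> 0 \<le> B s (s + t)")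
    case True
    then show ?thesis using realize_vanishing ex_vanishing by blast
  next
    case False
    then show ?thesis using realize_sign_flips by (meson not_less)
  qed
  then show ?thesis
    using nonneg_minors_if_window_positive wedge_nonzero_if_window_positive[OF Z card]
    unfolding maps_into_plane_def by blast
qed

end

section \<open>Planes and their Pluecker points\<close>

lemma in_span_pairE:
  assumes "x \<in> span {u, v}"
  obtains a b where "x = a *\<^sub>R u + b *\<^sub>R v"
proof -
  obtain a where "x - a *\<^sub>R u \<in> span {v}" using assms unfolding span_insert by blast
  then obtain b where "x - a *\<^sub>R u = b *\<^sub>R v" unfolding span_singleton by blast
  then show thesis using that[of a b] by (simp add: algebra_simps)
qed

lemma plucker_span_pair: "plucker (span {u, v}) = proj_point (wedge u v)"
  unfolding plucker_def proj_point_def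
  span_eq
proof (rule conjI)
  show "{wedge x y | x y. x \<in> span {u, v} \<and> y \<in> span {u, v}} \<subseteq> span {wedge u v}"
  proof clarify
    fix x y assume "x \<in> span {u, v}" "y \<in> span {u, v}"
    then obtain a b c d where xy: "x = a *\<^sub>R u + b *\<^sub>R v" "y = c *\<^sub>R u + d *\<^sub>R v"
      by (elim in_span_pairE) blast
    have "wedge x y = (a * d - b * c) *\<^sub>R wedge u v"
      unfolding xy using wedge_commute[of v u] by (simp add: algebra_simps)
    then show "wedge x y \<in> span {wedge u v}" by (simp add: span_base span_scale)
  qed
  show "{wedge u v} \<subseteq> span {wedge x y | x y. x \<in> span {u, v} \<and> y \<in> span {u, v}}"
  proof -
    have "u \<in> span {u, v}" "v \<in> span {u, v}" by (simp_all add: span_base)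
    then show ?thesis by (auto intro!: span_base)
  qed
qed

lemma dim_span_pair_le: "dim (span {x, y}) \<le> 2"
  using dim_le_card'[of "{x, y}"] by (simp add: card_insert_if split: if_splits)

lemma dim_span_pair:
  assumes "wedge u v \<noteq> 0"
  shows "dim (span {u, v}) = 2"
proof -
  have "u \<noteq> v" "v \<noteq> 0" using assms by auto
  moreover have "u \<notin> span {v}"
    using assms by (auto simp: span_singleton)
  ultimately have "independent {u, v}" by (simp add: independent_insert)
  then show ?thesis using \<open>u \<noteq> v\<close> by (simp add: dim_eq_card_independent)
qed

lemma dim_span_pair_less:
  fixes x y :: "real ^ 'n"
  assumes "\<And>i j. x $ i * y $ j = x $ j * y $ i"
  shows "dim (span {x, y}) < 2"
proof -
  obtain z where "span {x, y} \<subseteq> span {z}"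
  proof (cases "x = 0")
    case True
    then show ?thesis using that[of y] by (simp add: span_insert_0)
  next
    case False
    then obtain i where "x $ i \<noteq> 0" by (auto simp: vec_eq_iff)
    then have "y = (y $ i / x $ i) *\<^sub>R x"
      using assms[of i] by (simp add: vec_eq_iff field_simps)
    moreover have "(y $ i / x $ i) *\<^sub>R x \<in> span {x}" by (simp add: span_base span_scale)
    ultimately have "y \<in> span {x}" by simp
    then have "span {x, y} \<subseteq> span {x}" by (intro span_minimal) (auto intro: span_base)
    then show ?thesis by (rule that)
  qed
  then have "dim (span {x, y}) \<le> card {z}" by (intro dim_le_card) auto
  then show ?thesis by simp
qed

lemma wedge_sum_left: "wedge (\<Sum>i\<in>I. f i) y = (\<Sum>i\<in>I. wedge (f i) y)"
  by (induction I rule: infinite_finite_induct) simp_all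

lemma wedge_sum_right: "wedge x (\<Sum>i\<in>I. f i) = (\<Sum>i\<in>I. wedge x (f i))"
  by (induction I rule: infinite_finite_induct) simp_all

text \<open>This is the Cauchy-Binet formula: after bilinear expansion the diagonal terms vanish,
  and the terms of \<open>(i, j)\<close> and \<open>(j, i)\<close> combine to a minor.\<close>

lemma wedge_image_eq_ext_comb:
  fixes Z :: "real ^ 'n::{finite,linorder} ^ 4"
  shows "wedge (Z *v x) (Z *v y) = ext_comb Z (\<lambda>i j. x $ i * y $ j - x $ j * y $ i)"
proof -
  let ?c = "\<lambda>i. column i Z"
  define g where "g p = (x $ fst p * y $ snd p) *\<^sub>R wedge (?c (fst p)) (?c (snd p))" for p
  define U where "U = {(i, j :: 'n). i < j}"
  have "wedge (Z *v x) (Z *v y) = (\<Sum>i\<in>UNIV. \<Sum>j\<in>UNIV. g (i, j))"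
    unfolding matrix_mult_sum scalar_mult_eq_scaleR wedge_sum_left unfolding wedge_sum_right
    by (simp add: g_def mult.commute)
  also have "\<dots> = sum g UNIV"
    by (simp add: sum.cartesian_product)
  also have "\<dots> = sum g (U \<union> prod.swap ` U)"
  proof (rule sum.mono_neutral_right)
    show "\<forall>p\<in>UNIV - (U \<union> prod.swap ` U). g p = 0"
    proof
      fix p assume "p \<in> UNIV - (U \<union> prod.swap ` U)"
      then have "fst p = snd p" unfolding U_def
        by (cases p) (auto simp: image_iff not_less_iff_gr_or_eq)
      then show "g p = 0" by (simp add: g_def)
    qed
  qed auto
  also have "\<dots> = sum g U + sum g (prod.swap ` U)"
    by (rule sum.union_disjoint) (auto simp: U_def)
  also have "sum g (prod.swap ` U) = (\<Sum>p\<in>U. g (prod.swap p))"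
    by (subst sum.reindex) (auto simp: inj_on_def)
  also have "sum g U + (\<Sum>p\<in>U. g (prod.swap p)) = ext_comb Z (\<lambda>i j. x $ i * y $ j - x $ j * y $ i)"
    unfolding ext_comb_def U_def[symmetric] sum.distrib[symmetric]
  proof (rule sum.cong[OF refl])
    fix p assume "p \<in> U"
    obtain i j where p: "p = (i, j)" by force
    show "g p + g (prod.swap p)
        = (case p of (i, j) \<Rightarrow> (x $ i * y $ j - x $ j * y $ i) *\<^sub>R wedge (?c i) (?c j))"
      using wedge_commute[of "?c j" "?c i"] by (simp add: g_def p algebra_simps)
  qed
  finally show ?thesis .
qed

lemma row_span_pair: "row_span (M :: real ^ 'n ^ 2) = span {M $ 1, M $ 2}"
proof -
  have "M $ i = M $ 1 \<or> M $ i = M $ 2" for i using exhaust_2[of i] by auto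
  then have "rows M = {M $ 1, M $ 2}"
    unfolding rows_def row_def vec_lambda_eta by blast
  then show ?thesis unfolding row_span_def by simp
qed

lemma row_span_mult_transpose:
  "row_span ((M :: real ^ 'n ^ 2) ** transpose Z) = (\<lambda>x. Z *v x) ` row_span M"
proof -
  have "(M ** transpose Z) $ r = Z *v (M $ r)" for r
    by (simp add: vec_eq_iff matrix_matrix_mult_def matrix_vector_mult_def transpose_def mult.commute)
  then show ?thesis
    by (simp add: row_span_pair linear_span_image[OF matrix_vector_mul_linear, symmetric])
qed

lemma minor_det:
  "det (\<chi> r s. M $ r $ (if s = 1 then i else j) :: real ^ 2 ^ 2) = M $ 1 $ i * M $ 2 $ j - M $ 1 $ j * M $ 2 $ i"
  for M :: "real ^ 'n ^ 2"
  by (simp add: det_2)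

lemma amplituhedron_iff:
  fixes Z :: "real ^ 'n::{finite,linorder} ^ 4"
  shows "V \<in> amplituhedron Z \<longleftrightarrow> (\<exists>x y. V = span {Z *v x, Z *v y} \<and> dim (span {x, y}) = 2 \<and>
     (\<forall>i j. i < j \<longrightarrow> 0 \<le> x $ i * y $ j - x $ j * y $ i))" (is "_ \<longleftrightarrow> ?R")
proof
  assume "V \<in> amplituhedron Z"
  then obtain M :: "real ^ 'n::{finite,linorder} ^ 2" where V: "V = row_span (M ** transpose Z)"
    and M: "row_span M \<in> nonneg_grassmannian_2" unfolding amplituhedron_def by blast
  \<comment> \<open>The representative with non-negative minors may differ from \<open>M\<close>;
    the image depends only on the row span.\<close>
  obtain M' :: "real ^ 'n::{finite,linorder} ^ 2" where M': "row_span M = row_span M'"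
    "\<forall>i j. i < j \<longrightarrow> 0 \<le> M' $ 1 $ i * M' $ 2 $ j - M' $ 1 $ j * M' $ 2 $ i" "dim (row_span M) = 2"
    using M unfolding nonneg_grassmannian_2_def grassmannian_def minor_det by blast
  have "V = span {Z *v (M' $ 1), Z *v (M' $ 2)}"
    unfolding V row_span_mult_transpose M'(1) unfolding row_span_pair
    by (simp add: linear_span_image[OF matrix_vector_mul_linear, symmetric])
  then show ?R using M' unfolding row_span_pair by metis
next
  assume ?R
  then obtain x y where V: "V = span {Z *v x, Z *v y}" and d: "dim (span {x, y}) = 2"
    and nn: "\<forall>i j. i < j \<longrightarrow> 0 \<le> x $ i * y $ j - x $ j * y $ i" by blast
  define M :: "real ^ 'n::{finite,linorder} ^ 2" where "M = (\<chi> r. if r = 1 then x else y)"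
  have M: "M $ 1 = x" "M $ 2 = y" by (simp_all add: M_def)
  have "row_span M \<in> nonneg_grassmannian_2"
    unfolding nonneg_grassmannian_2_def grassmannian_def minor_det
    using d nn by (auto simp: row_span_pair M subspace_span intro!: exI[of _ M])
  moreover have "V = row_span (M ** transpose Z)"
    unfolding V row_span_mult_transpose unfolding row_span_pair M
    by (simp add: linear_span_image[OF matrix_vector_mul_linear, symmetric])
  ultimately show "V \<in> amplituhedron Z" unfolding amplituhedron_def by blast
qed

lemma ext_comb_nonzero:
  fixes Z :: "real ^ 'n::{finite,linorder} ^ 4"
  assumes "4 \<le> CARD('n)" "maximal_minors_positive Z"
    and c: "\<And>i j. i < j \<Longrightarrow> 0 \<le> c i j" "k < l" "c k l \<noteq> 0"
  shows "ext_comb Z c \<noteq> 0"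
proof -
  obtain L where L: "\<forall>g\<in>generators CARD('n) (zeta Z). 0 < pairing g L"
    using ex_positive_functional[OF pos_seq_zeta[OF assms(2), of 0] assms(1)] by auto
  have pos: "0 < pairing (wedge (column i Z) (column j Z)) L" if "i < j" for i j
    using L that unfolding generators_columns by blast
  have "0 < pairing (ext_comb Z c) L"
    unfolding pairing_ext_comb
  proof (rule sum_pos2[of _ "(k, l)"])
    show "0 < (case (k, l) of (i, j) \<Rightarrow> c i j * pairing (wedge (column i Z) (column j Z)) L)"
      using pos[of k l] c(1)[of k l] c(2,3) by simp
  qed (use c pos in \<open>auto intro!: mult_nonneg_nonneg less_imp_le[OF pos]\<close>)
  then show ?thesis by auto
qed

section \<open>The inclusions between the three sets\<close>

lemma plucker_amplituhedron_subset:
  fixes Z :: "real ^ 'n::{finite,linorder} ^ 4"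
  assumes Z: "4 \<le> CARD('n)" "maximal_minors_positive Z"
  shows "plucker ` amplituhedron Z \<subseteq> plucker ` grassmannian 2 \<inter> ext_cyclic_polytope Z"
proof clarify
  fix V assume "V \<in> amplituhedron Z"
  then obtain x y where V: "V = span {Z *v x, Z *v y}" and d: "dim (span {x, y}) = 2"
    and nn: "\<forall>i j. i < j \<longrightarrow> 0 \<le> x $ i * y $ j - x $ j * y $ i"
    unfolding amplituhedron_iff by blast
  define c where "c i j = x $ i * y $ j - x $ j * y $ i" for i j
  have "\<exists>i j. i < j \<and> c i j \<noteq> 0"
  proof (rule ccontr)
    assume "\<not> ?thesis"
    then have "x $ i * y $ j = x $ j * y $ i" for i j
      by (cases i j rule: linorder_cases) (auto simp: c_def algebra_simps)
    then show False using dim_span_pair_less[of x y] d by simp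
  qed
  then obtain k l where kl: "k < l" "c k l \<noteq> 0" by blast
  have w: "wedge (Z *v x) (Z *v y) = ext_comb Z c"
    by (simp add: wedge_image_eq_ext_comb c_def[abs_def])
  have nnc: "0 \<le> c i j" if "i < j" for i j using nn that by (simp add: c_def)
  have ne: "ext_comb Z c \<noteq> 0"
    using nnc kl by (rule ext_comb_nonzero[OF Z])
  have "V \<in> grassmannian 2"
    unfolding grassmannian_def V using dim_span_pair[of "Z *v x" "Z *v y"] ne w by (simp add: subspace_span)
  moreover have "plucker V = proj_point (ext_comb Z c)" unfolding V plucker_span_pair w ..
  then have "plucker V \<in> ext_cyclic_polytope Z"
    unfolding ext_cyclic_polytope_def using nnc kl ne by blast
  ultimately show "plucker V \<in> plucker ` grassmannian 2 \<inter> ext_cyclic_polytope Z" by blast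
qed

lemma ext_cyclic_polytope_subset: "ext_cyclic_polytope Z \<subseteq> schubert_ext_cyclic_polytope Z"
proof
  fix P assume "P \<in> ext_cyclic_polytope Z"
  then obtain c where c: "P = proj_point (ext_comb Z c)" "\<forall>i j. i < j \<longrightarrow> 0 \<le> c i j" "ext_comb Z c \<noteq> 0"
    unfolding ext_cyclic_polytope_def by blast
  then have "ext_comb Z c \<in> ext_cyclic_cone Z" unfolding ext_cyclic_cone_def by blast
  then show "P \<in> schubert_ext_cyclic_polytope Z"
    using c unfolding schubert_ext_cyclic_polytope_def supports_facet_def by blast
qed

lemma grassmannian_2E:
  assumes "V \<in> grassmannian 2"
  obtains u v where "V = span {u, v}"
proof -
  obtain S where S: "S \<subseteq> V" "independent S" "V \<subseteq> span S" "card S = dim V"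
    using basis_exists by blast
  have V: "subspace V" "dim V = 2" using assms unfolding grassmannian_def by auto
  then obtain u v where "S = {u, v}" using S(4) card_2_iff[of S] by auto
  moreover have "V = span S" using S V(1) by (simp add: span_minimal subset_antisym)
  ultimately show thesis using that by blast
qed

lemma grassmannian_schubert_subset:
  fixes Z :: "real ^ 'n::{finite,linorder} ^ 4"
  assumes Z: "4 \<le> CARD('n)" "maximal_minors_positive Z"
  shows "plucker ` grassmannian 2 \<inter> schubert_ext_cyclic_polytope Z \<subseteq> plucker ` amplituhedron Z"
proof clarify
  fix V assume V: "V \<in> grassmannian 2" and "plucker V \<in> schubert_ext_cyclic_polytope Z"
  then obtain Y where Y: "plucker V = proj_point Y" "Y \<noteq> 0"
    and ineq: "\<forall>F L. schubert_facet Z F \<and> supports_facet Z L F \<longrightarrow> 0 \<le> pairing Y L"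
    unfolding schubert_ext_cyclic_polytope_def by blast
  obtain u0 v where V0: "V = span {u0, v}" using V by (rule grassmannian_2E)
  have "Y \<in> span {wedge u0 v}"
    using Y span_base[of Y "{Y}"] unfolding V0 plucker_span_pair proj_point_def by simp
  then obtain t where t: "Y = t *\<^sub>R wedge u0 v" unfolding span_singleton by blast
  \<comment> \<open>The factor \<open>t\<close> may be negative. It is absorbed into
    \<open>u\<close>, so that the inequalities hold for \<open>wedge u v\<close> with the right
    sign.\<close>
  define u where "u = t *\<^sub>R u0"
  have Yuv: "Y = wedge u v" by (simp add: t u_def)
  have "span {u, v} \<subseteq> V" unfolding V0 u_def
    by (intro span_minimal) (auto intro: span_base span_scale)
  moreover have "dim (span {u, v}) = 2" using dim_span_pair Y(2) Yuv by blast
  ultimately have Vuv: "span {u, v} = V"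
    using V unfolding grassmannian_def by (intro subspace_dim_equal) auto
  interpret schubert_line Z u v
  proof
    let ?n = "CARD('n)"
    show "4 \<le> ?n" "maximal_minors_positive Z" by (fact Z)+
    show "wedge u v \<noteq> 0" using Y Yuv by simp
    fix s
    let ?X = "\<lambda>t. zeta Z (s + t)"
    have X: "pos_seq ?n ?X" by (rule pos_seq_zeta[OF Z(2)])
    have "decomposable (wedge (?X 0) (?X 1))" unfolding decomposable_def by blast
    \<comment> \<open>The facets are found in the shifted window and transferred by
      \<open>generators_zeta\<close>, since all windows have the same generators.\<close>
    from schubert_inequality[OF facet_functional_edge[OF X Z(1), unfolded generators_zeta] this ineq]
    show "0 \<le> pairing (wedge u v) (wedge (zeta Z s) (zeta Z (s + 1)))"
      unfolding Yuv by simp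
    fix j assume j: "2 \<le> j" "j \<le> ?n - 2"
    have "0 < br (?X 0) (?X 1) (?X j) (?X (?n - 1))"
      using pos_seqD[OF X, of 0 1 j "?n - 1"] j Z(1) by simp
    then have "decomposable (plane_meet (?X 0) (?X 1) (?X (?n - 1)) (?X (j - 1)) (?X j) (?X (j + 1)))"
      by (intro decomposable_plane_meet) simp
    from schubert_inequality[OF facet_functional_plane_meet[OF X j, unfolded generators_zeta] this ineq]
    show "0 \<le> pairing (wedge u v) (plane_meet (zeta Z s) (zeta Z (s + 1)) (zeta Z (s + (?n - 1)))
        (zeta Z (s + (j - 1))) (zeta Z (s + j)) (zeta Z (s + (j + 1))))"
      unfolding Yuv by simp
  qed
  obtain x y where xy: "Z *v x \<in> V" "Z *v y \<in> V" "wedge (Z *v x) (Z *v y) \<noteq> 0"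
    "\<forall>i j. i < j \<longrightarrow> 0 \<le> x $ i * y $ j - x $ j * y $ i"
    using realizable unfolding Vuv by blast
  have d: "dim (span {Z *v x, Z *v y}) = 2" using xy(3) by (rule dim_span_pair)
  have "span {Z *v x, Z *v y} = V"
  proof (rule subspace_dim_equal)
    show "subspace V" "dim V \<le> dim (span {Z *v x, Z *v y})"
      using V d unfolding grassmannian_def by auto
    then show "span {Z *v x, Z *v y} \<subseteq> V" using xy(1,2) by (intro span_minimal) auto
  qed simp
  moreover have "dim (span {x, y}) = 2"
  proof -
    have "span {Z *v x, Z *v y} = (\<lambda>x. Z *v x) ` span {x, y}"
      by (simp add: linear_span_image[OF matrix_vector_mul_linear, symmetric])
    then have "2 \<le> dim (span {x, y})"
      using dim_image_le[OF matrix_vector_mul_linear, of Z "span {x, y}"] d by simp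
    then show ?thesis using dim_span_pair_le[of x y] by simp
  qed
  ultimately have "V \<in> amplituhedron Z" unfolding amplituhedron_iff using xy(4) by blast
  then show "plucker V \<in> plucker ` amplituhedron Z" by blast
qed

theorem theorem6p12:
  fixes Z :: "real ^ 'n::{finite,linorder} ^ 4"
  assumes "CARD('n) \<ge> 4"
    and "maximal_minors_positive Z"
  shows "plucker ` amplituhedron Z = plucker ` grassmannian 2 \<inter> ext_cyclic_polytope Z
       \<and> plucker ` grassmannian 2 \<inter> ext_cyclic_polytope Z
         = plucker ` grassmannian 2 \<inter> schubert_ext_cyclic_polytope Z"
  \<comment> \<open>The three inclusions close a cycle.\<close>
  using plucker_amplituhedron_subset[OF assms] grassmannian_schubert_subset[OF assms]
    ext_cyclic_polytope_subset[of Z] by blast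

end
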